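(* Let $\alpha_0>0$ and $\lambda_0>0$ be fixed, and let $u\in\mathcal E((0,\infty),L^2(S^2))$ satisfy $\|u\|_{L^2(\mathbb R^3)}=1$, $u_\lambda=0$ in $L^2(S^2)$ only for $\lambda=\lambda_0$ in $(0,\infty)$, and $1+\alpha_0\gamma(\langle\langle u,u\rangle\rangle,\lambda_0)=0$. For $\alpha>0$ let $H_\alpha=H_0+\alpha\langle\cdot,u\rangle u$ on $L^2(\mathbb R^3)$, where $H_0=-\Delta$. Then for any fixed $h\in\mathbb R$: (a) $\displaystyle\lim_{\alpha\to\alpha_0}\overline\sigma_\alpha(\lambda_h(\alpha))=\frac{4\pi}{\lambda_0}\,\frac{1}{h^2+1}$. (b) There exists a sequence $\{\alpha_k\}$ converging to $\alpha_0$ such that $$\lim_{k\to\infty}f_{\alpha_k}(\lambda_h(\alpha_k);\omega_0\to\omega)=-\frac{4\pi}{\sqrt{\lambda_0}}\,\frac{u'_{\lambda_0}(\omega)\,\overline{u'_{\lambda_0}(\omega_0)}}{|||u'_{\lambda_0}|||^2}\,\frac{1}{h+i}\quad\text{for a.e. }(\omega_0,\omega)\in S^2\times S^2 .$$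
   Context: Inner products are linear in the first argument. $H_0$ is the self-adjoint realization of $-\Delta$ on $L^2(\mathbb R^3)$ with domain $\{v\in L^2(\mathbb R^3):|\xi|^2\hat v\in L^2(\mathbb R^3)\}$; $H_\alpha$ has the same domain. $S^2$ is the unit sphere in $\mathbb R^3$ with surface area measure; $\langle\langle\cdot,\cdot\rangle\rangle$ and $|||\cdot|||$ are the inner product and norm of $L^2(S^2)$. The unitary $U:L^2(\mathbb R^3)\to L^2([0,\infty),L^2(S^2))$, $(Uv)_\lambda(\omega)=2^{-1/2}\lambda^{1/4}\hat v(\sqrt\lambda\,\omega)=:v_\lambda(\omega)$ ($\hat v$ the unitary Fourier transform), diagonalizes $H_0$ as multiplication by $\lambda$; vectors $v\in L^2(\mathbb R^3)$ are identified with $(v_\lambda)_\lambda$. The function $\langle\langle v,w\rangle\rangle$ on $\mathbb R$ is $\lambda\mapsto\langle\langle v_\lambda,w_\lambda\rangle\rangle$ for $\lambda>0$, extended by $0$ for $\lambda\le0$. $\mathcal E((0,\infty),L^2(S^2))$ is the space of all strongly smooth functions $v\in L^2([0,\infty),L^2(S^2))$ (smooth in $\lambda\in(0,\infty)$) such that $|||v_\lambda|||$ and $|||v_{1/\lambda}|||$ decrease rapidly as $\lambda\to\infty$. $u'_{\lambda_0}$ is the strong derivative of $\lambda\mapsto u_\lambda$ at $\lambda_0$. $\gamma(f,\lambda)=\lim_{\epsilon\to0^+}\int_{\mathbb R\setminus(\lambda-\epsilon,\lambda+\epsilon)}\frac{f(x)}{x-\lambda}\,dx$ is the Cauchy principal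 value, used here for $f=\langle\langle u,u\rangle\rangle$ and $\lambda>0$. For $\lambda>0$: $G_1(\alpha,\lambda)=1+\alpha\gamma(\langle\langle u,u\rangle\rangle,\lambda)$, $G_2(\alpha,\lambda)=\alpha\pi|||u_\lambda|||^2$, $G=G_1+iG_2$; $G(\alpha,\lambda)\neq0$ for $\alpha>0$, $\alpha\ne\alpha_0$, $\lambda>0$. Let $\phi_\lambda=u_\lambda/(\lambda-\lambda_0)$ for $\lambda\ne\lambda_0$ and $\phi_{\lambda_0}=u'_{\lambda_0}$ (an eigenvector of $H_{\alpha_0}$ for the eigenvalue $\lambda_0$). Let $J\subset(0,\infty)$ be an open interval containing $\alpha_0$ and $\alpha\mapsto\lambda(\alpha)\in(0,\infty)$ a $C^1$ function on $J$ with $\lambda(\alpha_0)=\lambda_0$ and $G_1(\alpha,\lambda(\alpha))=0$ for $\alpha\in J$ (these exist by the implicit function theorem). For $\alpha\in J$ put $\kappa(\alpha)=\pi|||u_{\lambda(\alpha)}|||^2/\|\phi\|^2$ and $\lambda_h(\alpha)=\lambda(\alpha)+h\kappa(\alpha)$ (positive for $\alpha$ near $\alpha_0$). For $\alpha>0$, $\alpha\ne\alpha_0$, $\lambda>0$, let $R^{(\alpha)}_\lambda=S^{(\alpha)}_\lambda-I=-\frac{2\pi i\alpha}{G(\alpha,\lambda)}\langle\langle\cdot,u_\lambda\rangle\rangle u_\lambda$ on $L^2(S^2)$, where $S^{(\alpha)}_\lambda$ is the scattering matrix at energy $\lambda$ of the pair $(H_0,H_\alpha)$, i.e. the component at $\lambda$,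 in the representation $U$, of $S^{(\alpha)}=\Omega_+^{(\alpha)*}\Omega_-^{(\alpha)}$ with $\Omega_\pm^{(\alpha)}$ the strong limits of $e^{itH_\alpha}e^{-itH_0}$ as $t\to\pm\infty$. The total scattering cross-section is $\overline\sigma_\alpha(\lambda)=\pi\lambda^{-1}\|R^{(\alpha)}_\lambda\|_2^2$ with $\|\cdot\|_2$ the Hilbert–Schmidt norm. The scattering amplitude is $f_\alpha(\lambda;\omega_0\to\omega)=-2\pi i\lambda^{-1/2}R^{(\alpha)}_\lambda(\omega,\omega_0)=-\frac{4\pi^2\alpha}{\sqrt\lambda}\frac{u_\lambda(\omega)\overline{u_\lambda(\omega_0)}}{G(\alpha,\lambda)}$, where $R^{(\alpha)}_\lambda(\cdot,\cdot)$ is the integral kernel of $R^{(\alpha)}_\lambda$. These quantities are considered for $\alpha\ne\alpha_0$, and limits $\alpha\to\alpha_0$ are over such $\alpha$. *)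

theory Defs
  imports "HOL-Analysis.Analysis"
begin

text \<open>
  Elements of an \<open>L\<^sup>2\<close> space are represented by square-integrable functions; equality of
  elements is equality almost everywhere, and operators are functions on representatives.
\<close>

definition l2 :: "'a measure \<Rightarrow> ('a \<Rightarrow> complex) \<Rightarrow> bool" where
  "l2 M f \<longleftrightarrow> f \<in> borel_measurable M \<and> integrable M (\<lambda>x. (cmod (f x))\<^sup>2)"

definition l2_inner :: "'a measure \<Rightarrow> ('a \<Rightarrow> complex) \<Rightarrow> ('a \<Rightarrow> complex) \<Rightarrow> complex" where
  "l2_inner M f g = (LINT x|M. f x * cnj (g x))"

definition l2_norm :: "'a measure \<Rightarrow> ('a \<Rightarrow> complex) \<Rightarrow> real" where
  "l2_norm M f = sqrt (LINT x|M. (cmod (f x))\<^sup>2)"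

text \<open>Bounded linear operators on \<open>L\<^sup>2\<close>; boundedness and linearity make \<open>A\<close> respect a.e. equality.\<close>

definition l2_operator :: "'a measure \<Rightarrow> (('a \<Rightarrow> complex) \<Rightarrow> ('a \<Rightarrow> complex)) \<Rightarrow> bool" where
  "l2_operator M A \<longleftrightarrow>
     (\<forall>v. l2 M v \<longrightarrow> l2 M (A v)) \<and>
     (\<forall>a b v w. l2 M v \<longrightarrow> l2 M w \<longrightarrow>
        (AE x in M. A (\<lambda>y. a * v y + b * w y) x = a * A v x + b * A w x)) \<and>
     (\<exists>C. \<forall>v. l2 M v \<longrightarrow> l2_norm M (A v) \<le> C * l2_norm M v)"

definition orthonormal_basis :: "'a measure \<Rightarrow> (nat \<Rightarrow> 'a \<Rightarrow> complex) \<Rightarrow> bool" where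
  "orthonormal_basis M e \<longleftrightarrow>
     (\<forall>n. l2 M (e n)) \<and>
     (\<forall>m n. l2_inner M (e m) (e n) = (if m = n then 1 else 0)) \<and>
     (\<forall>v \<epsilon>. l2 M v \<longrightarrow> 0 < \<epsilon> \<longrightarrow>
        (\<exists>N c. l2_norm M (\<lambda>x. v x - (\<Sum>n<N. c n * e n x)) < \<epsilon>))"

text \<open>The value does not depend on the orthonormal basis \<open>e\<close>.\<close>

definition hs_norm ::
  "'a measure \<Rightarrow> (nat \<Rightarrow> 'a \<Rightarrow> complex) \<Rightarrow> (('a \<Rightarrow> complex) \<Rightarrow> ('a \<Rightarrow> complex)) \<Rightarrow> real" where
  "hs_norm M e A = sqrt (\<Sum>n. (l2_norm M (A (e n)))\<^sup>2)"

definition integral_kernel ::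
  "'a measure \<Rightarrow> (('a \<Rightarrow> complex) \<Rightarrow> ('a \<Rightarrow> complex)) \<Rightarrow> ('a \<Rightarrow> 'a \<Rightarrow> complex) \<Rightarrow> bool" where
  "integral_kernel M A K \<longleftrightarrow>
     l2 (M \<Otimes>\<^sub>M M) (\<lambda>(x, y). K x y) \<and>
     (\<forall>v. l2 M v \<longrightarrow> (AE x in M. A v x = (LINT y|M. K x y * v y)))"

text \<open>
  Surface area on the unit sphere as cone measure: the area of \<open>B\<close> is three times the volume
  of \<open>{r \<omega> | 0 < r < 1, \<omega> \<in> B}\<close>.
\<close>

definition S2 :: "(real^3) measure" where
  "S2 = scale_measure 3
     (distr (restrict_space lborel (ball 0 1 - {0})) (restrict_space borel (sphere 0 1))
       (\<lambda>x. x /\<^sub>R norm x))"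

text \<open>
  \<open>is_fourier v w\<close>: \<open>w\<close> is the unitary Fourier transform of \<open>v \<in> L\<^sup>2(\<real>\<^sup>3)\<close>, i.e. the
  \<open>L\<^sup>2\<close>-limit of the transforms of the truncations of \<open>v\<close> to balls.
\<close>

definition is_fourier :: "(real^3 \<Rightarrow> complex) \<Rightarrow> (real^3 \<Rightarrow> complex) \<Rightarrow> bool" where
  "is_fourier v w \<longleftrightarrow> l2 lborel v \<and> l2 lborel w \<and>
     ((\<lambda>r. l2_norm lborel (\<lambda>\<xi>. w \<xi> -
         complex_of_real ((2 * pi) powr (-3/2)) *
         (LINT x:cball 0 r|lborel. exp (- \<i> * complex_of_real (\<xi> \<bullet> x)) * v x))) \<longlongrightarrow> 0) at_top"

text \<open>\<open>is_H0 v g\<close>: \<open>v\<close> is in the domain of \<open>H\<^sub>0 = -\<Delta>\<close> and \<open>g = H\<^sub>0 v\<close>.\<close>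

definition is_H0 :: "(real^3 \<Rightarrow> complex) \<Rightarrow> (real^3 \<Rightarrow> complex) \<Rightarrow> bool" where
  "is_H0 v g \<longleftrightarrow> (\<exists>w. is_fourier v w \<and> l2 lborel (\<lambda>\<xi>. complex_of_real ((norm \<xi>)\<^sup>2) * w \<xi>) \<and>
     is_fourier g (\<lambda>\<xi>. complex_of_real ((norm \<xi>)\<^sup>2) * w \<xi>))"

definition is_H ::
  "(real^3 \<Rightarrow> complex) \<Rightarrow> real \<Rightarrow> (real^3 \<Rightarrow> complex) \<Rightarrow> (real^3 \<Rightarrow> complex) \<Rightarrow> bool" where
  "is_H u \<alpha> v g \<longleftrightarrow> (\<exists>g0. is_H0 v g0 \<and>
     (AE x in lborel. g x = g0 x + complex_of_real \<alpha> * l2_inner lborel v u * u x))"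

text \<open>
  \<open>unitary_group A W\<close>: \<open>W t = exp (i t A)\<close>, i.e. \<open>W\<close> is the strongly continuous one-parameter
  unitary group on \<open>L\<^sup>2(\<real>\<^sup>3)\<close> with generator \<open>i A\<close>, where \<open>A\<close> is given by its graph.
\<close>

definition unitary_group ::
  "((real^3 \<Rightarrow> complex) \<Rightarrow> (real^3 \<Rightarrow> complex) \<Rightarrow> bool) \<Rightarrow>
   (real \<Rightarrow> (real^3 \<Rightarrow> complex) \<Rightarrow> (real^3 \<Rightarrow> complex)) \<Rightarrow> bool" where
  "unitary_group A W \<longleftrightarrow>
     (\<forall>t. l2_operator lborel (W t)) \<and>
     (\<forall>t v. l2 lborel v \<longrightarrow> l2_norm lborel (W t v) = l2_norm lborel v) \<and>
     (\<forall>v. l2 lborel v \<longrightarrow> (AE x in lborel. W 0 v x = v x)) \<and>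
     (\<forall>s t v. l2 lborel v \<longrightarrow> (AE x in lborel. W (s + t) v x = W s (W t v) x)) \<and>
     (\<forall>v. l2 lborel v \<longrightarrow> ((\<lambda>t. l2_norm lborel (\<lambda>x. W t v x - v x)) \<longlongrightarrow> 0) (at 0)) \<and>
     (\<forall>v g. l2 lborel v \<longrightarrow> l2 lborel g \<longrightarrow>
        (A v g \<longleftrightarrow>
          ((\<lambda>t. l2_norm lborel (\<lambda>x. (W t v x - v x) / complex_of_real t - \<i> * g x)) \<longlongrightarrow> 0) (at 0)))"

text \<open>
  \<open>is_spec_rep v V\<close>: the family \<open>V \<mu>\<close>, \<open>\<mu> > 0\<close>, is \<open>U v\<close>, where
  \<open>(U v)\<^sub>\<mu>(\<omega>) = 2\<^sup>-\<^sup>1\<^sup>/\<^sup>2 \<mu>\<^sup>1\<^sup>/\<^sup>4 v^(\<surd>\<mu> \<omega>)\<close> for almost every \<open>\<mu>\<close>. For \<open>\<mu> \<le> 0\<close> the values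
  \<open>V \<mu>\<close> carry no meaning.
\<close>

definition is_spec_rep :: "(real^3 \<Rightarrow> complex) \<Rightarrow> (real \<Rightarrow> real^3 \<Rightarrow> complex) \<Rightarrow> bool" where
  "is_spec_rep v V \<longleftrightarrow> (\<forall>\<mu>>0. l2 S2 (V \<mu>)) \<and>
     (\<exists>w. is_fourier v w \<and>
       (AE \<mu> in lborel. 0 < \<mu> \<longrightarrow>
         (AE \<omega> in S2. V \<mu> \<omega> = complex_of_real (\<mu> powr (1/4) / sqrt 2) * w (sqrt \<mu> *\<^sub>R \<omega>))))"

definition has_strong_derivative ::
  "(real \<Rightarrow> real^3 \<Rightarrow> complex) \<Rightarrow> (real^3 \<Rightarrow> complex) \<Rightarrow> real \<Rightarrow> bool" where
  "has_strong_derivative V V' \<mu> \<longleftrightarrow> l2 S2 V' \<and>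
     ((\<lambda>t. l2_norm S2 (\<lambda>\<omega>. (V (\<mu> + t) \<omega> - V \<mu> \<omega>) / complex_of_real t - V' \<omega>)) \<longlongrightarrow> 0) (at 0)"

text \<open>
  The space \<open>\<E>((0,\<infinity>), L\<^sup>2(S\<^sup>2))\<close>. Strong measurability in \<open>\<mu>\<close> is automatic, since strongly
  smooth families are norm continuous.
\<close>

definition smooth_rapid :: "(real \<Rightarrow> real^3 \<Rightarrow> complex) \<Rightarrow> bool" where
  "smooth_rapid V \<longleftrightarrow>
     (\<forall>\<mu>>0. l2 S2 (V \<mu>)) \<and>
     set_integrable lborel {0<..} (\<lambda>\<mu>. (l2_norm S2 (V \<mu>))\<^sup>2) \<and>
     (\<exists>D. D 0 = V \<and> (\<forall>n. \<forall>\<mu>>0. has_strong_derivative (D n) (D (Suc n) \<mu>) \<mu>)) \<and>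
     (\<forall>n::nat. ((\<lambda>\<mu>. \<mu> ^ n * l2_norm S2 (V \<mu>)) \<longlongrightarrow> 0) at_top) \<and>
     (\<forall>n::nat. ((\<lambda>\<mu>. \<mu> ^ n * l2_norm S2 (V (1 / \<mu>))) \<longlongrightarrow> 0) at_top)"

text \<open>
  \<open>scattering_matrix u \<alpha> S\<close>: the family \<open>S \<mu>\<close>, \<open>\<mu> > 0\<close>, is the scattering matrix of the pair
  \<open>(H\<^sub>0, H\<^sub>\<alpha>)\<close>, i.e. \<open>\<Omega>\<^sub>+\<^sup>* \<Omega>\<^sub>-\<close> acts in the representation \<open>U\<close> as multiplication by \<open>S \<mu>\<close>.
  Here \<open>\<Omega>p\<close>, \<open>\<Omega>m\<close> are the strong limits of \<open>exp (i t H\<^sub>\<alpha>) exp (- i t H\<^sub>0)\<close> as \<open>t \<rightarrow> \<plusminus>\<infinity>\<close> and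
  \<open>\<Omega>a\<close> is the adjoint of \<open>\<Omega>p\<close>. This determines \<open>S \<mu>\<close> for almost every \<open>\<mu>\<close> only.
\<close>

definition scattering_matrix ::
  "(real^3 \<Rightarrow> complex) \<Rightarrow> real \<Rightarrow> (real \<Rightarrow> (real^3 \<Rightarrow> complex) \<Rightarrow> (real^3 \<Rightarrow> complex)) \<Rightarrow> bool" where
  "scattering_matrix u \<alpha> S \<longleftrightarrow>
     (\<forall>\<mu>>0. l2_operator S2 (S \<mu>)) \<and>
     (\<exists>W0 W \<Omega>p \<Omega>m \<Omega>a.
       unitary_group is_H0 W0 \<and> unitary_group (is_H u \<alpha>) W \<and>
       l2_operator lborel \<Omega>p \<and> l2_operator lborel \<Omega>m \<and> l2_operator lborel \<Omega>a \<and>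
       (\<forall>v. l2 lborel v \<longrightarrow>
          ((\<lambda>t. l2_norm lborel (\<lambda>x. W t (W0 (- t) v) x - \<Omega>p v x)) \<longlongrightarrow> 0) at_top \<and>
          ((\<lambda>t. l2_norm lborel (\<lambda>x. W t (W0 (- t) v) x - \<Omega>m v x)) \<longlongrightarrow> 0) at_bot) \<and>
       (\<forall>v w. l2 lborel v \<longrightarrow> l2 lborel w \<longrightarrow>
          l2_inner lborel (\<Omega>p v) w = l2_inner lborel v (\<Omega>a w)) \<and>
       (\<forall>v V Y. is_spec_rep v V \<longrightarrow> is_spec_rep (\<Omega>a (\<Omega>m v)) Y \<longrightarrow>
          (AE \<mu> in lborel. 0 < \<mu> \<longrightarrow> (AE \<omega> in S2. Y \<mu> \<omega> = S \<mu> (V \<mu>) \<omega>))))"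

definition pv_integral :: "(real \<Rightarrow> real) \<Rightarrow> real \<Rightarrow> real" where
  "pv_integral f \<mu> =
     Lim (at_right 0) (\<lambda>\<epsilon>. LINT x:(- {\<mu> - \<epsilon> <..< \<mu> + \<epsilon>})|lborel. f x / (x - \<mu>))"

text \<open>The function \<open>\<langle>\<langle>u,u\<rangle>\<rangle>\<close> on the line; its values are real.\<close>

definition bracket :: "(real \<Rightarrow> real^3 \<Rightarrow> complex) \<Rightarrow> real \<Rightarrow> real" where
  "bracket V \<mu> = (if 0 < \<mu> then Re (l2_inner S2 (V \<mu>) (V \<mu>)) else 0)"

definition G1 :: "(real \<Rightarrow> real^3 \<Rightarrow> complex) \<Rightarrow> real \<Rightarrow> real \<Rightarrow> real" where
  "G1 V \<alpha> \<mu> = 1 + \<alpha> * pv_integral (bracket V) \<mu>"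

definition G2 :: "(real \<Rightarrow> real^3 \<Rightarrow> complex) \<Rightarrow> real \<Rightarrow> real \<Rightarrow> real" where
  "G2 V \<alpha> \<mu> = \<alpha> * pi * (l2_norm S2 (V \<mu>))\<^sup>2"

definition G :: "(real \<Rightarrow> real^3 \<Rightarrow> complex) \<Rightarrow> real \<Rightarrow> real \<Rightarrow> complex" where
  "G V \<alpha> \<mu> = complex_of_real (G1 V \<alpha> \<mu>) + \<i> * complex_of_real (G2 V \<alpha> \<mu>)"

text \<open>The vector \<open>\<phi>\<close> in the representation \<open>U\<close>, with \<open>V'\<close> the strong derivative of \<open>V\<close> at \<open>\<mu>0\<close>.\<close>

definition phi ::
  "(real \<Rightarrow> real^3 \<Rightarrow> complex) \<Rightarrow> (real^3 \<Rightarrow> complex) \<Rightarrow> real \<Rightarrow> real \<Rightarrow> real^3 \<Rightarrow> complex" where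
  "phi V V' \<mu>0 \<mu> = (if \<mu> = \<mu>0 then V' else (\<lambda>\<omega>. V \<mu> \<omega> / complex_of_real (\<mu> - \<mu>0)))"

text \<open>The norm of \<open>L\<^sup>2([0,\<infinity>), L\<^sup>2(S\<^sup>2))\<close>, which is the norm of \<open>L\<^sup>2(\<real>\<^sup>3)\<close> transported by \<open>U\<close>.\<close>

definition spec_norm :: "(real \<Rightarrow> real^3 \<Rightarrow> complex) \<Rightarrow> real" where
  "spec_norm V = sqrt (LINT \<mu>:{0<..}|lborel. (l2_norm S2 (V \<mu>))\<^sup>2)"

definition kappa ::
  "(real \<Rightarrow> real^3 \<Rightarrow> complex) \<Rightarrow> (real^3 \<Rightarrow> complex) \<Rightarrow> real \<Rightarrow> (real \<Rightarrow> real) \<Rightarrow> real \<Rightarrow> real" where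
  "kappa V V' \<mu>0 lam \<alpha> = pi * (l2_norm S2 (V (lam \<alpha>)))\<^sup>2 / (spec_norm (phi V V' \<mu>0))\<^sup>2"

definition lam_h ::
  "(real \<Rightarrow> real^3 \<Rightarrow> complex) \<Rightarrow> (real^3 \<Rightarrow> complex) \<Rightarrow> real \<Rightarrow> (real \<Rightarrow> real) \<Rightarrow> real \<Rightarrow> real \<Rightarrow> real" where
  "lam_h V V' \<mu>0 lam h \<alpha> = lam \<alpha> + h * kappa V V' \<mu>0 lam \<alpha>"

text \<open>Below, \<open>S\<close> is a single scattering matrix \<open>S \<mu>\<close> at a fixed energy.\<close>

definition remainder ::
  "((real^3 \<Rightarrow> complex) \<Rightarrow> (real^3 \<Rightarrow> complex)) \<Rightarrow> (real^3 \<Rightarrow> complex) \<Rightarrow> (real^3 \<Rightarrow> complex)" where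
  "remainder S v \<omega> = S v \<omega> - v \<omega>"

definition total_cross_section ::
  "(nat \<Rightarrow> real^3 \<Rightarrow> complex) \<Rightarrow> ((real^3 \<Rightarrow> complex) \<Rightarrow> (real^3 \<Rightarrow> complex)) \<Rightarrow> real \<Rightarrow> real" where
  "total_cross_section e S \<mu> = pi / \<mu> * (hs_norm S2 e (remainder S))\<^sup>2"

text \<open>
  The amplitude for scattering from direction \<open>\<omega>0\<close> to direction \<open>\<omega>\<close>, where \<open>K\<close> is the integral
  kernel of \<open>S - I\<close>, the outgoing direction being its first argument.
\<close>

definition scattering_amplitude ::
  "(real^3 \<Rightarrow> real^3 \<Rightarrow> complex) \<Rightarrow> real \<Rightarrow> real^3 \<Rightarrow> real^3 \<Rightarrow> complex" where
  "scattering_amplitude K \<mu> \<omega>0 \<omega> = - 2 * complex_of_real pi * \<i> / complex_of_real (sqrt \<mu>) * K \<omega> \<omega>0"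

end

theory Submission
  imports Defs
begin

text \<open>
  Put \<open>n(\<mu>) = |||u\<^sub>\<mu>|||\<^sup>2\<close> and \<open>\<gamma>(\<mu>) = \<gamma>(n, \<mu>)\<close>. The zero of the smooth function \<open>n\<close> at \<open>\<mu>0\<close>
  is double, so \<open>\<gamma>\<close> is strictly differentiable there with derivative
  \<open>\<integral> n(x) / (x - \<mu>0)\<^sup>2 dx = \<parallel>\<phi>\<parallel>\<^sup>2\<close>. Since \<open>1 + \<alpha> \<gamma>(\<lambda>(\<alpha>)) = 0\<close>, this gives
  \<open>G\<^sub>1(\<alpha>, \<lambda>\<^sub>h(\<alpha>)) \<sim> \<alpha> h \<kappa>(\<alpha>) \<parallel>\<phi>\<parallel>\<^sup>2 = \<alpha> \<pi> h n(\<lambda>(\<alpha>))\<close>, while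
  \<open>G\<^sub>2(\<alpha>, \<lambda>\<^sub>h(\<alpha>)) = \<alpha> \<pi> n(\<lambda>\<^sub>h(\<alpha>)) \<sim> \<alpha> \<pi> n(\<lambda>(\<alpha>))\<close>, because \<open>\<lambda>\<^sub>h(\<alpha>) - \<lambda>(\<alpha>)\<close> is a
  multiple of \<open>n(\<lambda>(\<alpha>))\<close> and \<open>n'\<close> vanishes at \<open>\<mu>0\<close>. Hence
  \<open>\<alpha> n(\<lambda>\<^sub>h(\<alpha>)) / G(\<alpha>, \<lambda>\<^sub>h(\<alpha>)) \<rightarrow> 1 / (\<pi> (h + i))\<close>. The remainder of the scattering matrix has
  rank one, so its Hilbert-Schmidt norm is \<open>2 \<pi>\<close> times the modulus of this quotient, and its
  kernel is the quotient times the normalized kernel of \<open>u\<^sub>\<lambda> / (\<lambda> - \<mu>0)\<close>, which tends to \<open>u'\<close>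
  in \<open>L\<^sup>2(S\<^sup>2)\<close> and therefore almost everywhere along a subsequence.
\<close>

section \<open>Square-integrable functions\<close>

lemma l2_measurable: "l2 M f \<Longrightarrow> f \<in> borel_measurable M"
  by (simp add: l2_def)

lemma l2_integrable_mult:
  assumes "l2 M f" "l2 M g"
  shows "integrable M (\<lambda>x. f x * cnj (g x))"
proof (rule Bochner_Integration.integrable_bound)
  show "integrable M (\<lambda>x. (cmod (f x))\<^sup>2 + (cmod (g x))\<^sup>2)"
    using assms by (auto simp: l2_def)
  show "(\<lambda>x. f x * cnj (g x)) \<in> borel_measurable M"
    using assms unfolding l2_def
    by (intro borel_measurable_times measurable_compose[of g M borel cnj borel]
        borel_measurable_continuous_onI continuous_on_cnj continuous_on_id) auto
  show "AE x in M. norm (f x * cnj (g x)) \<le> norm ((cmod (f x))\<^sup>2 + (cmod (g x))\<^sup>2)"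
  proof (rule AE_I2)
    fix x
    have "2 * (cmod (f x) * cmod (g x)) \<le> (cmod (f x))\<^sup>2 + (cmod (g x))\<^sup>2"
      using sum_squares_bound[of "cmod (f x)" "cmod (g x)"] by simp
    moreover have "0 \<le> cmod (f x) * cmod (g x)" by simp
    ultimately show "norm (f x * cnj (g x)) \<le> norm ((cmod (f x))\<^sup>2 + (cmod (g x))\<^sup>2)"
      unfolding norm_mult complex_mod_cnj real_norm_def by linarith
  qed
qed

lemma l2_cmult:
  assumes "l2 M f"
  shows "l2 M (\<lambda>x. c * f x)"
  using assms by (auto simp: l2_def norm_mult power_mult_distrib)

lemma l2_add:
  assumes "l2 M f" "l2 M g"
  shows "l2 M (\<lambda>x. f x + g x)"
proof -
  have "integrable M (\<lambda>x. (cmod (f x + g x))\<^sup>2)"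
  proof (rule Bochner_Integration.integrable_bound)
    show "integrable M (\<lambda>x. 2 * (cmod (f x))\<^sup>2 + 2 * (cmod (g x))\<^sup>2)"
      using assms by (auto simp: l2_def)
    show "(\<lambda>x. (cmod (f x + g x))\<^sup>2) \<in> borel_measurable M"
      using assms by (auto simp: l2_def)
    show "AE x in M. norm ((cmod (f x + g x))\<^sup>2) \<le> norm (2 * (cmod (f x))\<^sup>2 + 2 * (cmod (g x))\<^sup>2)"
    proof (rule AE_I2)
      fix x
      have "(cmod (f x + g x))\<^sup>2 \<le> (cmod (f x) + cmod (g x))\<^sup>2"
        by (simp add: norm_triangle_ineq)
      also have "\<dots> \<le> 2 * (cmod (f x))\<^sup>2 + 2 * (cmod (g x))\<^sup>2"
        using sum_squares_bound[of "cmod (f x)" "cmod (g x)"] by (simp add: power2_sum)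
      finally show "norm ((cmod (f x + g x))\<^sup>2) \<le> norm (2 * (cmod (f x))\<^sup>2 + 2 * (cmod (g x))\<^sup>2)"
        by simp
    qed
  qed
  with assms show ?thesis by (auto simp: l2_def)
qed

lemma l2_diff:
  assumes "l2 M f" "l2 M g"
  shows "l2 M (\<lambda>x. f x - g x)"
  using l2_add[OF assms(1) l2_cmult[OF assms(2), of "-1"]] by simp

lemma l2_divide:
  assumes "l2 M f"
  shows "l2 M (\<lambda>x. f x / c)"
  using l2_cmult[OF assms, of "inverse c"] by (simp add: field_simps)

lemma l2_zero: "l2 M (\<lambda>x. 0)"
  by (simp add: l2_def)

lemma l2_sum:
  assumes "\<And>i. i \<in> I \<Longrightarrow> l2 M (f i)"
  shows "l2 M (\<lambda>x. \<Sum>i\<in>I. f i x)"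
  using assms by (induction I rule: infinite_finite_induct) (auto intro: l2_zero l2_add)

lemma l2_inner_add_left:
  assumes "l2 M f" "l2 M g" "l2 M k"
  shows "l2_inner M (\<lambda>x. f x + g x) k = l2_inner M f k + l2_inner M g k"
  using assms by (simp add: l2_inner_def ring_distribs l2_integrable_mult)

lemma l2_inner_diff_left:
  assumes "l2 M f" "l2 M g" "l2 M k"
  shows "l2_inner M (\<lambda>x. f x - g x) k = l2_inner M f k - l2_inner M g k"
  using assms by (simp add: l2_inner_def left_diff_distrib l2_integrable_mult)

lemma l2_inner_cmult_left: "l2_inner M (\<lambda>x. c * f x) g = c * l2_inner M f g"
  by (simp add: l2_inner_def mult.assoc)

lemma l2_inner_commute: "l2_inner M g f = cnj (l2_inner M f g)"
  unfolding l2_inner_def using Bochner_Integration.integral_cnj[of M "\<lambda>x. f x * cnj (g x)"] by (simp add: mult.commute)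

lemma l2_inner_diff_right:
  assumes "l2 M f" "l2 M g" "l2 M k"
  shows "l2_inner M k (\<lambda>x. f x - g x) = l2_inner M k f - l2_inner M k g"
  unfolding l2_inner_commute[of M k] by (simp add: l2_inner_diff_left assms)

lemma l2_inner_cmult_right: "l2_inner M f (\<lambda>x. c * g x) = cnj c * l2_inner M f g"
  using l2_inner_commute[of M f "\<lambda>x. c * g x"] l2_inner_commute[of M f g]
  by (simp add: l2_inner_cmult_left)

lemma l2_norm_power2: "(l2_norm M f)\<^sup>2 = (LINT x|M. (cmod (f x))\<^sup>2)"
  by (simp add: l2_norm_def)

lemma l2_inner_self: "l2_inner M f f = complex_of_real ((l2_norm M f)\<^sup>2)"
  unfolding l2_norm_power2 l2_inner_def complex_norm_square[symmetric]
  by (rule integral_complex_of_real)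

lemma l2_norm_nonneg: "0 \<le> l2_norm M f"
  by (simp add: l2_norm_def)

lemma l2_norm_cmult: "l2_norm M (\<lambda>x. c * f x) = cmod c * l2_norm M f"
  by (simp add: l2_norm_def norm_mult power_mult_distrib real_sqrt_mult)

lemma l2_norm_cong_AE:
  assumes "AE x in M. f x = g x" "f \<in> borel_measurable M" "g \<in> borel_measurable M"
  shows "l2_norm M f = l2_norm M g"
proof -
  have "(LINT x|M. (cmod (f x))\<^sup>2) = (LINT x|M. (cmod (g x))\<^sup>2)"
    using assms by (intro integral_cong_AE) auto
  then show ?thesis by (simp add: l2_norm_def)
qed

lemma l2_norm_eq_0_iff:
  assumes "l2 M f"
  shows "l2_norm M f = 0 \<longleftrightarrow> (AE x in M. f x = 0)"
  using assms integral_nonneg_eq_0_iff_AE[of M "\<lambda>x. (cmod (f x))\<^sup>2"]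
  by (auto simp: l2_norm_def l2_def)

text \<open>The weighted inequality 2 a b <= s a^2 + b^2 / s is integrated, and the weight
  \<open>s\<close> is then chosen as the ratio of the two norms. If one of the norms is zero, the
  integrand vanishes almost everywhere.\<close>

lemma l2_Cauchy_Schwarz:
  assumes f: "l2 M f" and g: "l2 M g"
  shows "cmod (l2_inner M f g) \<le> l2_norm M f * l2_norm M g"
proof -
  have le: "cmod (l2_inner M f g) \<le> (s * (l2_norm M f)\<^sup>2 + (l2_norm M g)\<^sup>2 / s) / 2"
    if s: "s > 0" for s
  proof -
    have "cmod (l2_inner M f g) \<le> (LINT x|M. cmod (f x * cnj (g x)))"
      unfolding l2_inner_def by (rule integral_norm_bound)
    also have "\<dots> \<le> (LINT x|M. (s * (cmod (f x))\<^sup>2 + (cmod (g x))\<^sup>2 / s) / 2)"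
    proof (rule integral_mono)
      show "integrable M (\<lambda>x. cmod (f x * cnj (g x)))"
        using l2_integrable_mult[OF f g] by (rule integrable_norm)
      show "integrable M (\<lambda>x. (s * (cmod (f x))\<^sup>2 + (cmod (g x))\<^sup>2 / s) / 2)"
        using f g by (auto simp: l2_def)
      fix x
      have "0 \<le> (s * cmod (f x) - cmod (g x))\<^sup>2 / s" using s by simp
      also have "\<dots> = s * (cmod (f x))\<^sup>2 + (cmod (g x))\<^sup>2 / s - 2 * (cmod (f x) * cmod (g x))"
        using s by (simp add: power2_diff field_simps power2_eq_square)
      finally show "cmod (f x * cnj (g x)) \<le> (s * (cmod (f x))\<^sup>2 + (cmod (g x))\<^sup>2 / s) / 2"
        by (simp add: norm_mult)
    qed
    also have "\<dots> = (s * (l2_norm M f)\<^sup>2 + (l2_norm M g)\<^sup>2 / s) / 2"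
      using f g by (simp add: l2_norm_power2 l2_def)
    finally show ?thesis .
  qed
  show ?thesis
  proof (cases "l2_norm M f = 0 \<or> l2_norm M g = 0")
    case True
    then have "AE x in M. f x * cnj (g x) = 0"
      using l2_norm_eq_0_iff[OF f] l2_norm_eq_0_iff[OF g] by auto
    then have "l2_inner M f g = 0"
      unfolding l2_inner_def by (rule integral_eq_zero_AE)
    then show ?thesis by (simp add: l2_norm_nonneg)
  next
    case False
    then have pos: "l2_norm M f > 0" "l2_norm M g > 0"
      using l2_norm_nonneg[of M f] l2_norm_nonneg[of M g] by auto
    show ?thesis
      using le[of "l2_norm M g / l2_norm M f"] pos by (simp add: field_simps power2_eq_square)
  qed
qed

text \<open>The difference of the inner products splits into two terms linear in the errors and one
  quadratic term, each bounded by Cauchy-Schwarz. Square-integrability is asked only eventually,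
  since difference quotients at \<open>\<mu> + t\<close> are controlled only while
  \<open>\<mu> + t\<close> is positive.\<close>

lemma l2_inner_tendsto:
  assumes "\<forall>\<^sub>F t in F. l2 M (f t)" "\<forall>\<^sub>F t in F. l2 M (g t)" and f0: "l2 M f0" and g0: "l2 M g0"
    and f: "((\<lambda>t. l2_norm M (\<lambda>x. f t x - f0 x)) \<longlongrightarrow> 0) F"
    and g: "((\<lambda>t. l2_norm M (\<lambda>x. g t x - g0 x)) \<longlongrightarrow> 0) F"
  shows "((\<lambda>t. l2_inner M (f t) (g t)) \<longlongrightarrow> l2_inner M f0 g0) F"
proof (rule LIM_zero_cancel)
  let ?r = "\<lambda>t. l2_norm M (\<lambda>x. f t x - f0 x)" and ?s = "\<lambda>t. l2_norm M (\<lambda>x. g t x - g0 x)"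
  have lim: "((\<lambda>t. ?r t * l2_norm M g0 + l2_norm M f0 * ?s t + ?r t * ?s t)
      \<longlongrightarrow> 0 * l2_norm M g0 + l2_norm M f0 * 0 + 0 * 0) F"
    by (intro tendsto_intros f g)
  show "((\<lambda>t. l2_inner M (f t) (g t) - l2_inner M f0 g0) \<longlongrightarrow> 0) F"
  proof (rule Lim_null_comparison)
    show "((\<lambda>t. ?r t * l2_norm M g0 + l2_norm M f0 * ?s t + ?r t * ?s t) \<longlongrightarrow> 0) F"
      using lim by simp
    show "\<forall>\<^sub>F t in F. cmod (l2_inner M (f t) (g t) - l2_inner M f0 g0)
        \<le> ?r t * l2_norm M g0 + l2_norm M f0 * ?s t + ?r t * ?s t"
      using assms(1,2)
    proof eventually_elim
      case (elim t)
      let ?f = "\<lambda>x. f t x - f0 x" and ?g = "\<lambda>x. g t x - g0 x"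
      have l: "l2 M ?f" "l2 M ?g"
        using elim f0 g0 by (auto intro: l2_diff)
      have eq: "l2_inner M (f t) (g t) - l2_inner M f0 g0
          = l2_inner M ?f g0 + l2_inner M f0 ?g + l2_inner M ?f ?g"
        using elim f0 g0 l by (simp add: l2_inner_diff_left l2_inner_diff_right)
      have "cmod (l2_inner M (f t) (g t) - l2_inner M f0 g0)
          \<le> cmod (l2_inner M ?f g0) + cmod (l2_inner M f0 ?g) + cmod (l2_inner M ?f ?g)"
        unfolding eq
        using norm_triangle_ineq[of "l2_inner M ?f g0 + l2_inner M f0 ?g" "l2_inner M ?f ?g"]
          norm_triangle_ineq[of "l2_inner M ?f g0" "l2_inner M f0 ?g"] by linarith
      also have "\<dots> \<le> ?r t * l2_norm M g0 + l2_norm M f0 * ?s t + ?r t * ?s t"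
        by (intro add_mono l2_Cauchy_Schwarz l f0 g0)
      finally show ?case .
    qed
  qed
qed


text \<open>Product rule: with difference quotients a and b, the quotient of the inner product is
  <a, B> + <A, b> + t <a, b>, and the last term disappears in the limit.\<close>

lemma has_derivative_Re_l2_inner:
  assumes A: "has_strong_derivative A A' \<mu>" and B: "has_strong_derivative B B' \<mu>"
    and l2A: "\<And>\<nu>. \<nu> > 0 \<Longrightarrow> l2 S2 (A \<nu>)" and l2B: "\<And>\<nu>. \<nu> > 0 \<Longrightarrow> l2 S2 (B \<nu>)"
    and "\<mu> > 0"
  shows "((\<lambda>\<nu>. Re (l2_inner S2 (A \<nu>) (B \<nu>))) has_real_derivative
      Re (l2_inner S2 A' (B \<mu>)) + Re (l2_inner S2 (A \<mu>) B')) (at \<mu>)"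
proof -
  let ?a = "\<lambda>t \<omega>. (A (\<mu> + t) \<omega> - A \<mu> \<omega>) / complex_of_real t"
  let ?b = "\<lambda>t \<omega>. (B (\<mu> + t) \<omega> - B \<mu> \<omega>) / complex_of_real t"
  have "((\<lambda>t. \<mu> + t) \<longlongrightarrow> \<mu> + 0) (at 0)"
    by (intro tendsto_intros)
  then have pos: "\<forall>\<^sub>F t in at 0. \<mu> + t > 0"
    using \<open>\<mu> > 0\<close> by (intro order_tendstoD) auto
  have a: "\<forall>\<^sub>F t in at 0. l2 S2 (?a t)" and b: "\<forall>\<^sub>F t in at 0. l2 S2 (?b t)"
    using pos by (auto elim!: eventually_mono intro!: l2_divide l2_diff l2A l2B \<open>\<mu> > 0\<close>)
  \<comment> \<open>This serves the argument that stays fixed in each of the two linear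
    terms.\<close>
  have z: "((\<lambda>t. l2_norm S2 (\<lambda>\<omega>. X \<omega> - X \<omega>)) \<longlongrightarrow> 0) (at 0)" for X
    by (simp add: l2_norm_def)
  have A': "l2 S2 A'" and a_lim: "((\<lambda>t. l2_norm S2 (\<lambda>\<omega>. ?a t \<omega> - A' \<omega>)) \<longlongrightarrow> 0) (at 0)"
    and B': "l2 S2 B'" and b_lim: "((\<lambda>t. l2_norm S2 (\<lambda>\<omega>. ?b t \<omega> - B' \<omega>)) \<longlongrightarrow> 0) (at 0)"
    using A B by (auto simp: has_strong_derivative_def)
  have Am: "l2 S2 (A \<mu>)" and Bm: "l2 S2 (B \<mu>)"
    using l2A l2B \<open>\<mu> > 0\<close> by auto
  have "((\<lambda>t. l2_inner S2 (?a t) (B \<mu>) + l2_inner S2 (A \<mu>) (?b t) + t * l2_inner S2 (?a t) (?b t))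
      \<longlongrightarrow> l2_inner S2 A' (B \<mu>) + l2_inner S2 (A \<mu>) B' + complex_of_real 0 * l2_inner S2 A' B') (at 0)"
    by (intro tendsto_add tendsto_mult tendsto_of_real tendsto_ident_at
        l2_inner_tendsto a b a_lim b_lim A' B' z always_eventually allI Am Bm)
  then have "((\<lambda>t. Re (l2_inner S2 (?a t) (B \<mu>) + l2_inner S2 (A \<mu>) (?b t) + t * l2_inner S2 (?a t) (?b t)))
      \<longlongrightarrow> Re (l2_inner S2 A' (B \<mu>) + l2_inner S2 (A \<mu>) B')) (at 0)"
    by (intro tendsto_Re) simp
  moreover have "\<forall>\<^sub>F t in at 0.
      Re (l2_inner S2 (?a t) (B \<mu>) + l2_inner S2 (A \<mu>) (?b t) + t * l2_inner S2 (?a t) (?b t))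
      = (Re (l2_inner S2 (A (\<mu> + t)) (B (\<mu> + t))) - Re (l2_inner S2 (A \<mu>) (B \<mu>))) / t"
    using pos eventually_neq_at_within[of 0 0 UNIV]
  proof eventually_elim
    case (elim t)
    have l: "l2 S2 (A (\<mu> + t))" "l2 S2 (B (\<mu> + t))" "l2 S2 (\<lambda>\<omega>. A (\<mu> + t) \<omega> - A \<mu> \<omega>)" "l2 S2 (\<lambda>\<omega>. B (\<mu> + t) \<omega> - B \<mu> \<omega>)"
      using elim l2A l2B Am Bm by (auto intro: l2_diff)
    have q: "?a t = (\<lambda>\<omega>. complex_of_real (inverse t) * (A (\<mu> + t) \<omega> - A \<mu> \<omega>))"
            "?b t = (\<lambda>\<omega>. complex_of_real (inverse t) * (B (\<mu> + t) \<omega> - B \<mu> \<omega>))"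
      by (auto simp: divide_inverse mult.commute)
    have "l2_inner S2 (?a t) (B \<mu>) + l2_inner S2 (A \<mu>) (?b t) + t * l2_inner S2 (?a t) (?b t)
        = (l2_inner S2 (A (\<mu> + t)) (B (\<mu> + t)) - l2_inner S2 (A \<mu>) (B \<mu>)) / complex_of_real t"
      unfolding q using elim Am Bm l
      by (simp add: l2_inner_cmult_left l2_inner_cmult_right l2_inner_diff_left l2_inner_diff_right
          del: of_real_inverse) (simp add: field_simps)
    then show ?case by simp
  qed
  ultimately have "((\<lambda>t. (Re (l2_inner S2 (A (\<mu> + t)) (B (\<mu> + t))) - Re (l2_inner S2 (A \<mu>) (B \<mu>))) / t)
      \<longlongrightarrow> Re (l2_inner S2 A' (B \<mu>) + l2_inner S2 (A \<mu>) B')) (at 0)"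
    by (rule Lim_transform_eventually)
  then show ?thesis by (simp add: DERIV_def)
qed

text \<open>Completing the square, one coordinate at a time. The coefficients are arbitrary: the
  Fourier coefficients give Bessel's inequality, while general ones show that no combination of the
  first \<open>N\<close> vectors approximates better than the Fourier sum.\<close>

lemma Bessel_defect:
  assumes e: "orthonormal_basis M e" and v: "l2 M v"
  shows "(l2_norm M (\<lambda>x. v x - (\<Sum>n<N. c n * e n x)))\<^sup>2
    = (l2_norm M v)\<^sup>2 - (\<Sum>n<N. (cmod (l2_inner M v (e n)))\<^sup>2) + (\<Sum>n<N. (cmod (c n - l2_inner M v (e n)))\<^sup>2)"
proof (induction N)
  case 0
  then show ?case by simp
next
  case (Suc N)
  let ?w = "\<lambda>x. v x - (\<Sum>n<N. c n * e n x)"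
  have l2e: "l2 M (e n)" and orth: "l2_inner M (e m) (e n) = (if m = n then 1 else 0)" for m n
    using e by (auto simp: orthonormal_basis_def)
  have w: "l2 M ?w"
    using v l2e by (intro l2_diff l2_sum l2_cmult)
  \<comment> \<open>The length \<open>k\<close> is separate from \<open>N\<close> so that the
    induction keeps the test vector \<open>e N\<close> fixed.\<close>
  have inner_sum: "l2_inner M (\<lambda>x. \<Sum>n<k. c n * e n x) (e N) = (\<Sum>n<k. c n * l2_inner M (e n) (e N))" for k
  proof (induction k)
    case (Suc k)
    then show ?case
      by (simp add: l2_inner_add_left l2_sum l2_cmult l2e l2_inner_cmult_left)
  qed (simp add: l2_inner_def)
  have we: "l2_inner M ?w (e N) = l2_inner M v (e N)"
    using v l2e by (simp add: l2_inner_diff_left l2_sum l2_cmult inner_sum orth)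
  have ew: "l2_inner M (e N) ?w = cnj (l2_inner M v (e N))"
    by (subst l2_inner_commute) (simp add: we)
  let ?z = "l2_inner M v (e N)"
  have "complex_of_real ((l2_norm M (\<lambda>x. ?w x - c N * e N x))\<^sup>2)
     = complex_of_real ((l2_norm M ?w)\<^sup>2) - cnj (c N) * ?z - c N * cnj ?z + c N * cnj (c N)"
    unfolding l2_inner_self[symmetric] using w l2e
    by (simp add: l2_inner_diff_left l2_inner_diff_right l2_diff l2_cmult l2_inner_cmult_left
        l2_inner_cmult_right we ew orth ring_distribs ac_simps)
  also have "\<dots> = complex_of_real ((l2_norm M ?w)\<^sup>2 - (cmod ?z)\<^sup>2 + (cmod (c N - ?z))\<^sup>2)"
    by (simp only: of_real_add of_real_diff complex_norm_square) (simp add: ring_distribs ac_simps)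
  finally have "(l2_norm M (\<lambda>x. ?w x - c N * e N x))\<^sup>2 = (l2_norm M ?w)\<^sup>2 - (cmod ?z)\<^sup>2 + (cmod (c N - ?z))\<^sup>2"
    by (simp only: of_real_eq_iff)
  with Suc show ?case by (simp add: algebra_simps)
qed

text \<open>Density provides one good approximation, by \<open>Bessel_defect\<close> the Fourier sum
  of the same length is at least as good, and longer sums stay between it and the Bessel bound. The
  identity is quadratic, hence the tolerance \<open>sqrt \<epsilon>\<close>.\<close>

lemma Parseval:
  assumes e: "orthonormal_basis M e" and v: "l2 M v"
  shows "(\<lambda>n. (cmod (l2_inner M v (e n)))\<^sup>2) sums (l2_norm M v)\<^sup>2"
  unfolding sums_def
proof (rule LIMSEQ_I)
  fix \<epsilon> :: real assume "\<epsilon> > 0"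
  then obtain N c where N: "l2_norm M (\<lambda>x. v x - (\<Sum>n<N. c n * e n x)) < sqrt \<epsilon>"
    using e v real_sqrt_gt_zero[of \<epsilon>] unfolding orthonormal_basis_def by blast
  let ?s = "\<lambda>N. \<Sum>n<N. (cmod (l2_inner M v (e n)))\<^sup>2"
  have "(l2_norm M (\<lambda>x. v x - (\<Sum>n<N. c n * e n x)))\<^sup>2 < \<epsilon>"
    using power_strict_mono[OF N l2_norm_nonneg, of 2] \<open>\<epsilon> > 0\<close> by simp
  moreover have "0 \<le> (\<Sum>n<N. (cmod (c n - l2_inner M v (e n)))\<^sup>2)"
    by (simp add: sum_nonneg)
  ultimately have 1: "(l2_norm M v)\<^sup>2 - ?s N < \<epsilon>"
    by (simp add: Bessel_defect[OF e v])
  have 2: "?s k \<le> (l2_norm M v)\<^sup>2" for k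
    using Bessel_defect[OF e v, where N = k and c = "\<lambda>n. l2_inner M v (e n)"]
      zero_le_power2[of "l2_norm M (\<lambda>x. v x - (\<Sum>n<k. l2_inner M v (e n) * e n x))"] by simp
  have 3: "?s N \<le> ?s k" if "k \<ge> N" for k
    using that by (intro sum_mono2) auto
  show "\<exists>no. \<forall>n\<ge>no. norm (?s n - (l2_norm M v)\<^sup>2) < \<epsilon>"
  proof (intro exI allI impI)
    fix k assume "k \<ge> N"
    from 1 2[of k] 3[OF this] show "norm (?s k - (l2_norm M v)\<^sup>2) < \<epsilon>" by simp
  qed
qed

text \<open>Each basis vector is sent to a multiple of \<open>v\<close> whose factor has modulus |c|
  |<v, e n>|, so Parseval sums the squares. Measurability of \<open>A w\<close> is a separate
  hypothesis because agreement almost everywhere does not supply it.\<close>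

lemma hs_norm_rank_one:
  assumes e: "orthonormal_basis M e" and v: "l2 M v"
    and A: "\<And>w. l2 M w \<Longrightarrow> A w \<in> borel_measurable M"
    and eq: "\<And>w. l2 M w \<Longrightarrow> AE x in M. A w x = c * l2_inner M w v * v x"
  shows "hs_norm M e A = cmod c * (l2_norm M v)\<^sup>2"
proof -
  have l2e: "l2 M (e n)" for n
    using e by (auto simp: orthonormal_basis_def)
  have "l2_norm M (A (e n)) = cmod c * cmod (l2_inner M v (e n)) * l2_norm M v" for n
  proof -
    have "l2_norm M (A (e n)) = l2_norm M (\<lambda>x. c * l2_inner M (e n) v * v x)"
      using v by (intro l2_norm_cong_AE eq A l2e) (auto simp: l2_def)
    then show ?thesis
      by (simp add: l2_norm_cmult norm_mult l2_inner_commute[of M "e n" v])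
  qed
  then have "(l2_norm M (A (e n)))\<^sup>2 = (cmod c * l2_norm M v)\<^sup>2 * (cmod (l2_inner M v (e n)))\<^sup>2" for n
    by (simp add: power_mult_distrib)
  moreover have "(\<lambda>n. (cmod c * l2_norm M v)\<^sup>2 * (cmod (l2_inner M v (e n)))\<^sup>2) sums
      ((cmod c * l2_norm M v)\<^sup>2 * (l2_norm M v)\<^sup>2)"
    by (intro sums_mult Parseval e v)
  ultimately have "(\<Sum>n. (l2_norm M (A (e n)))\<^sup>2) = (cmod c * l2_norm M v * l2_norm M v)\<^sup>2"
    by (simp add: sums_iff power_mult_distrib)
  then show ?thesis
    by (simp add: hs_norm_def power2_eq_square[of "l2_norm M v"] abs_mult l2_norm_nonneg)
qed

section \<open>Integral kernels\<close>

text \<open>The total mass is three times the volume of the punctured unit ball.\<close>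

lemma finite_measure_S2: "finite_measure S2"
proof
  let ?B = "restrict_space lborel (ball 0 1 - {0 :: real^3})"
  have B: "ball 0 1 - {0 :: real^3} \<in> sets borel" by auto
  have meas: "(\<lambda>x. x /\<^sub>R norm x) \<in> measurable ?B (restrict_space borel (sphere 0 1))"
    by (rule measurable_restrict_space2)
      (auto intro!: measurable_restrict_space1 simp: space_restrict_space)
  have S2_B: "emeasure S2 (space S2) = 3 * emeasure ?B (space ?B)"
    using measurable_space[OF meas]
    by (simp add: S2_def space_scale_measure emeasure_distr[OF meas] del: space_restrict_space2)
      (metis (no_types, lifting) Int_absorb1 subsetI vimageI)
  have "emeasure ?B (space ?B) = emeasure lborel (ball 0 1 - {0 :: real^3})"
    using B by (simp add: emeasure_restrict_space space_restrict_space)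
  also have "\<dots> \<le> emeasure lborel (ball 0 1 :: (real^3) set)"
    by (rule emeasure_mono) auto
  also have "\<dots> < \<infinity>" by (rule emeasure_lborel_ball_finite)
  finally have "emeasure ?B (space ?B) < \<infinity>" by simp
  then show "emeasure S2 (space S2) \<noteq> \<infinity>"
    unfolding S2_B by (simp add: ennreal_mult_eq_top_iff less_top[symmetric])
qed

text \<open>The product measure is invariant under exchange of the factors. This reconciles kernels,
  whose first argument is the outgoing direction, with pairs that list the incoming direction
  first.\<close>

lemma AE_pair_measure_swap:
  assumes "sigma_finite_measure M" "AE (x, y) in M \<Otimes>\<^sub>M M. P x y"
  shows "AE (x, y) in M \<Otimes>\<^sub>M M. P y x"
proof -
  interpret sigma_finite_measure M by fact
  interpret pair_sigma_finite M M ..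
  have "AE z in distr (M \<Otimes>\<^sub>M M) (M \<Otimes>\<^sub>M M) (\<lambda>(x, y). (y, x)). case z of (x, y) \<Rightarrow> P x y"
    using assms(2) unfolding distr_pair_swap[symmetric] .
  from AE_distrD[OF _ this] show ?thesis
    by (simp add: split_beta' measurable_pair_swap')
qed

text \<open>Testing an operator against indicator functions determines the integrals of its kernel
  over all rectangles.\<close>

lemma integral_kernel_unique:
  assumes M: "finite_measure M"
    and K: "integral_kernel M A K" and L: "integral_kernel M A L"
  shows "AE (x, y) in M \<Otimes>\<^sub>M M. K x y = L x y"
proof -
  interpret finite_measure M by fact
  interpret P: pair_sigma_finite M M ..
  interpret Pf: finite_measure "M \<Otimes>\<^sub>M M"
    by (rule finite_measure_pair_measure[OF M M])
  define D where "D = (\<lambda>z. K (fst z) (snd z) - L (fst z) (snd z))"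
  have l2: "l2 (M \<Otimes>\<^sub>M M) (\<lambda>z. K (fst z) (snd z))" "l2 (M \<Otimes>\<^sub>M M) (\<lambda>z. L (fst z) (snd z))"
    using K L by (auto simp: integral_kernel_def split_beta')
  \<comment> \<open>On a finite measure space the constant 1 is square-integrable, so pairing with
    it makes both kernels integrable.\<close>
  have one: "l2 (M \<Otimes>\<^sub>M M) (\<lambda>z. 1)"
    by (simp add: l2_def)
  have intK: "integrable (M \<Otimes>\<^sub>M M) (\<lambda>z. K (fst z) (snd z))"
    and intL: "integrable (M \<Otimes>\<^sub>M M) (\<lambda>z. L (fst z) (snd z))"
    using l2_integrable_mult[OF l2(1) one] l2_integrable_mult[OF l2(2) one] by auto
  have D: "integrable (M \<Otimes>\<^sub>M M) D"
    unfolding D_def by (intro Bochner_Integration.integrable_diff intK intL)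
  have rect: "(LINT z:X \<times> Y|M \<Otimes>\<^sub>M M. D z) = 0" if X: "X \<in> sets M" and Y: "Y \<in> sets M" for X Y
  proof -
    let ?i = "\<lambda>y. indicator Y y :: complex"
    have l2i: "l2 M ?i"
    proof -
      have "(\<lambda>y. (cmod (?i y))\<^sup>2) = indicator Y" by (auto simp: indicator_def)
      then show ?thesis
        using Y integrable_real_indicator[OF Y] by (simp add: l2_def emeasure_finite less_top[symmetric])
    qed
    have "AE x in M. (LINT y|M. K x y * ?i y) = (LINT y|M. L x y * ?i y)"
      using K L l2i unfolding integral_kernel_def by fastforce
    moreover have "AE x in M. integrable M (\<lambda>y. K x y)" "AE x in M. integrable M (\<lambda>y. L x y)"
      using P.AE_integrable_fst'[OF intK] P.AE_integrable_fst'[OF intL] by auto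
    ultimately have ae: "AE x in M. (LINT y|M. indicator (X \<times> Y) (x, y) *\<^sub>R D (x, y)) = 0"
    proof eventually_elim
      case (elim x)
      have int: "integrable M (\<lambda>y. K x y * ?i y)" "integrable M (\<lambda>y. L x y * ?i y)"
        using integrable_mult_indicator[OF Y elim(2)] integrable_mult_indicator[OF Y elim(3)]
        by (auto simp: scaleR_conv_of_real mult.commute of_real_indicator)
      have "(LINT y|M. indicator (X \<times> Y) (x, y) *\<^sub>R D (x, y))
          = (LINT y|M. indicator X x * (K x y * ?i y - L x y * ?i y))"
        by (intro Bochner_Integration.integral_cong) (auto simp: D_def indicator_def)
      also have "\<dots> = 0"
        using int elim(1) by simp
      finally show ?case .
    qed
    have "integrable (M \<Otimes>\<^sub>M M) (\<lambda>z. indicator (X \<times> Y) z *\<^sub>R D z)"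
      using X Y by (intro integrable_mult_indicator D) auto
    from P.integral_fst'[OF this] show ?thesis
      unfolding set_lebesgue_integral_def using integral_eq_zero_AE[OF ae] by simp
  qed
  have si: "set_integrable (M \<Otimes>\<^sub>M M) Z D" if "Z \<in> sets (M \<Otimes>\<^sub>M M)" for Z
    unfolding set_integrable_def using that by (intro integrable_mult_indicator D) auto
  \<comment> \<open>Dynkin's argument: rectangles form a generator stable under intersection, and a
    vanishing integral passes to complements and to countable disjoint unions.\<close>
  have all: "(LINT z:Z|M \<Otimes>\<^sub>M M. D z) = 0" if "Z \<in> sets (M \<Otimes>\<^sub>M M)" for Z
    using that[unfolded sets_pair_measure]
  proof (induction rule: sigma_sets_induct_disjoint[OF Int_stable_pair_measure_generator
        pair_measure_closed, consumes 1, case_names basic empty compl union])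
    case (basic Z)
    then show ?case using rect by auto
  next
    case empty
    then show ?case by (simp add: set_lebesgue_integral_def)
  next
    case (compl Z)
    have Z: "Z \<in> sets (M \<Otimes>\<^sub>M M)" using compl by (simp add: sets_pair_measure)
    have sp: "space M \<times> space M \<in> sets (M \<Otimes>\<^sub>M M)" by auto
    have "(LINT z:(space M \<times> space M - Z) \<union> Z|M \<Otimes>\<^sub>M M. D z)
        = (LINT z:space M \<times> space M - Z|M \<Otimes>\<^sub>M M. D z) + (LINT z:Z|M \<Otimes>\<^sub>M M. D z)"
      using Z sp by (intro set_integral_Un si) auto
    moreover have "(space M \<times> space M - Z) \<union> Z = space M \<times> space M"
      using sets.sets_into_space[OF Z] by (auto simp: space_pair_measure)
    ultimately show ?case using compl rect[of "space M" "space M"] by simp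
  next
    case (union F)
    have F: "range F \<subseteq> sets (M \<Otimes>\<^sub>M M)" using union by (simp add: sets_pair_measure)
    then have "(LINT z:(\<Union>i. F i)|M \<Otimes>\<^sub>M M. D z) = (\<Sum>i. (LINT z:F i|M \<Otimes>\<^sub>M M. D z))"
      using union by (intro lebesgue_integral_countable_add si) (auto simp: disjoint_family_on_def)
    then show ?case using union by simp
  qed
  have "AE z in M \<Otimes>\<^sub>M M. D z = 0"
    by (rule P.density_zero[OF D all])
  then show ?thesis by (simp add: D_def split_beta')
qed

section \<open>Kernels of rank-one operators\<close>

lemma l2_tensor:
  assumes "sigma_finite_measure M" "l2 M u"
  shows "l2 (M \<Otimes>\<^sub>M M) (\<lambda>(x, y). u x * cnj (u y))"
proof -
  interpret sigma_finite_measure M by fact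
  interpret pair_sigma_finite M M ..
  have u [measurable]: "u \<in> borel_measurable M" and int: "integrable M (\<lambda>x. (cmod (u x))\<^sup>2)"
    using assms by (auto simp: l2_def)
  have cnj_u: "(\<lambda>x. cnj (u x)) \<in> borel_measurable M"
    by (intro measurable_compose[OF u] borel_measurable_continuous_onI continuous_on_cnj continuous_on_id)
  have "integrable (M \<Otimes>\<^sub>M M) (\<lambda>(x, y). (cmod (u x))\<^sup>2 * (cmod (u y))\<^sup>2)"
    using int by (intro Fubini_integrable) (auto simp: norm_mult)
  moreover have "(\<lambda>(x, y). u x * cnj (u y)) \<in> borel_measurable (M \<Otimes>\<^sub>M M)"
    using cnj_u by measurable
  ultimately show ?thesis
    by (simp add: l2_def split_beta' norm_mult power_mult_distrib)
qed

lemma integral_kernel_rank_one: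
  assumes "sigma_finite_measure M" and u: "l2 M u"
    and A: "\<And>v. l2 M v \<Longrightarrow> AE x in M. A v x = c * l2_inner M v u * u x"
  shows "integral_kernel M A (\<lambda>x y. c * (u x * cnj (u y)))"
  unfolding integral_kernel_def
proof (intro conjI allI impI)
  show "l2 (M \<Otimes>\<^sub>M M) (\<lambda>(x, y). c * (u x * cnj (u y)))"
    using l2_cmult[OF l2_tensor[OF assms(1,2)], of c] by (simp add: split_beta')
  fix v assume v: "l2 M v"
  have "(LINT y|M. c * (u x * cnj (u y)) * v y) = (LINT y|M. c * u x * (v y * cnj (u y)))" for x
    by (simp add: ac_simps)
  then have "(LINT y|M. c * (u x * cnj (u y)) * v y) = c * l2_inner M v u * u x" for x
    by (simp add: l2_inner_def)
  then show "AE x in M. A v x = (LINT y|M. c * (u x * cnj (u y)) * v y)"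
    using A[OF v] by simp
qed

section \<open>Principal values near a double zero\<close>

text \<open>Both sides are the second divided difference of a function at the nodes
  \<open>a\<close>, \<open>b\<close>, \<open>x\<close>, which is symmetric in its nodes.\<close>

lemma divided_difference_swap:
  fixes a b x fa fb fx :: real
  assumes "a \<noteq> b" "x \<noteq> a" "x \<noteq> b"
  shows "((fx - fa) / (x - a) - (fa - fb) / (a - b)) / (x - b)
       = ((fx - fb) / (x - b) - (fb - fa) / (b - a)) / (x - a)"
proof -
  have ne: "x - a \<noteq> 0" "x - b \<noteq> 0" "a - b \<noteq> 0" "b - a \<noteq> 0" using assms by auto
  show ?thesis
    using ne by (simp add: divide_simps) (simp add: algebra_simps)
qed

text \<open>For ordered nodes the mean value theorem turns the two first differences into values of
  \<open>p\<close> at points no farther apart than the outer nodes, so the Lipschitz bound cancels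
  the denominator. Symmetry reduces every order of the nodes to this one.\<close>

lemma divided_difference_bound:
  fixes f p :: "real \<Rightarrow> real"
  assumes der: "\<And>t. t \<in> {c..d} \<Longrightarrow> (f has_real_derivative p t) (at t)"
    and lip: "\<And>s t. s \<in> {c..d} \<Longrightarrow> t \<in> {c..d} \<Longrightarrow> \<bar>p s - p t\<bar> \<le> C * \<bar>s - t\<bar>"
    and x: "x \<in> {c..d}" "a \<in> {c..d}" "b \<in> {c..d}" "x \<noteq> a" "x \<noteq> b" "a \<noteq> b"
  shows "\<bar>((f x - f a) / (x - a) - (f a - f b) / (a - b)) / (x - b)\<bar> \<le> C"
proof -
  define Q where "Q x a b = ((f x - f a) / (x - a) - (f a - f b) / (a - b)) / (x - b)" for x a b
  have swap: "Q x a b = Q x b a" if "x \<noteq> a" "x \<noteq> b" "a \<noteq> b" for x a b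
    unfolding Q_def using divided_difference_swap that by blast
  \<comment> \<open>Reversal of the nodes and \<open>swap\<close> together generate all permutations
    of the three nodes.\<close>
  have rev: "Q x a b = Q b a x" for x a b
  proof -
    have flip: "(s - t) / (v - w) = (t - s) / (w - v)" for s t v w :: real
      using minus_divide_divide[of "s - t" "v - w"] by simp
    show ?thesis
      unfolding Q_def flip[of "f b" "f a"] flip[of "f a" "f x"] by (rule flip)
  qed
  have lt: "\<bar>Q x a b\<bar> \<le> C" if less: "x < a" "a < b" "c \<le> x" "b \<le> d" for x a b
  proof -
    have mvt: "\<exists>\<xi>. s < \<xi> \<and> \<xi> < t \<and> (f s - f t) / (s - t) = p \<xi>" if st: "s < t" "c \<le> s" "t \<le> d" for s t
    proof -
      have "\<exists>\<xi>. s < \<xi> \<and> \<xi> < t \<and> f t - f s = (t - s) * p \<xi>"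
        using st by (intro MVT2 der) auto
      then show ?thesis using st by (auto simp: field_simps)
    qed
    obtain \<xi> where \<xi>: "x < \<xi>" "\<xi> < a" "(f x - f a) / (x - a) = p \<xi>"
      using mvt[of x a] less by auto
    obtain \<eta> where \<eta>: "a < \<eta>" "\<eta> < b" "(f a - f b) / (a - b) = p \<eta>"
      using mvt[of a b] less by auto
    have le: "\<bar>p \<xi> - p \<eta>\<bar> \<le> C * \<bar>\<xi> - \<eta>\<bar>"
      using \<xi> \<eta> less by (intro lip) auto
    then have "0 \<le> C * \<bar>\<xi> - \<eta>\<bar>"
      using abs_ge_zero order_trans by blast
    moreover have "\<bar>\<xi> - \<eta>\<bar> > 0" using \<xi> \<eta> by simp
    ultimately have "C \<ge> 0" by (simp add: zero_le_mult_iff)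
    have "C * \<bar>\<xi> - \<eta>\<bar> \<le> C * \<bar>x - b\<bar>"
      using \<xi> \<eta> \<open>C \<ge> 0\<close> by (intro mult_left_mono) auto
    with le have "\<bar>p \<xi> - p \<eta>\<bar> \<le> C * \<bar>x - b\<bar>" by linarith
    then show ?thesis
      unfolding Q_def \<xi>(3) \<eta>(3) abs_divide using less by (simp add: divide_le_eq)
  qed
  have "\<bar>Q x a b\<bar> \<le> C"
  proof (cases "x < b")
    case True
    consider "a < x" | "x < a" "a < b" | "b < a" using x by linarith
    then show ?thesis
    proof cases
      case 1
      then have "Q x a b = Q a x b" using rev swap x by metis
      then show ?thesis using lt[of a x b] 1 True x by simp
    next
      case 2
      then show ?thesis using lt[of x a b] x by simp
    next
      case 3
      then have "Q x a b = Q x b a" using swap x by metis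
      then show ?thesis using lt[of x b a] 3 True x by simp
    qed
  next
    case False
    then have "b < x" using x by linarith
    consider "a < b" | "b < a" "a < x" | "x < a" using x by linarith
    then show ?thesis
    proof cases
      case 1
      then have "Q x a b = Q a b x" using rev swap x by metis
      then show ?thesis using lt[of a b x] 1 \<open>b < x\<close> x by simp
    next
      case 2
      then have "Q x a b = Q b a x" using rev by metis
      then show ?thesis using lt[of b a x] 2 x by simp
    next
      case 3
      then have "Q x a b = Q b x a" using rev swap x by metis
      then show ?thesis using lt[of b x a] 3 \<open>b < x\<close> x by simp
    qed
  qed
  then show ?thesis by (simp add: Q_def)
qed

text \<open>Here \<open>(f x - f a) / (x - a)\<close> on \<open>[c, d]\<close> removes the singularity, and the logarithms are the
  principal value of \<open>1 / (x - a)\<close> over \<open>[c, d]\<close>.\<close>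

definition pv_regularized :: "(real \<Rightarrow> real) \<Rightarrow> real \<Rightarrow> real \<Rightarrow> real \<Rightarrow> real \<Rightarrow> real" where
  "pv_regularized f c d a x = (f x - indicator {c..d} x * f a) / (x - a)"

text \<open>On \<open>{c..d}\<close> the quotient is bounded by the Lipschitz constant at
  \<open>a\<close>; outside, the denominator is at least the distance from \<open>a\<close> to the
  ends of the interval.\<close>

lemma integrable_pv_regularized:
  fixes f :: "real \<Rightarrow> real"
  assumes f: "integrable lborel f" and a: "c < a" "a < d"
    and lip: "\<And>x. x \<in> {c..d} \<Longrightarrow> \<bar>f x - f a\<bar> \<le> B * \<bar>x - a\<bar>"
  shows "integrable lborel (pv_regularized f c d a)"
proof (rule Bochner_Integration.integrable_bound)
  let ?m = "min (a - c) (d - a)"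
  have [measurable]: "f \<in> borel_measurable borel" using f by auto
  show "pv_regularized f c d a \<in> borel_measurable lborel"
    unfolding pv_regularized_def by measurable
  show "integrable lborel (\<lambda>x. \<bar>f x\<bar> / ?m + \<bar>B\<bar> * indicator {c..d} x)"
  proof (intro Bochner_Integration.integrable_add integrable_mult_right integrable_divide)
    show "integrable lborel (\<lambda>x. \<bar>f x\<bar>)"
      using f by simp
    show "integrable lborel (indicat_real {c..d})"
      by (rule integrable_real_indicator) (auto simp: emeasure_lborel_Icc_eq)
  qed
  show "AE x in lborel. norm (pv_regularized f c d a x) \<le> norm (\<bar>f x\<bar> / ?m + \<bar>B\<bar> * indicator {c..d} x)"
  proof (rule AE_I2)
    fix x
    have m: "?m > 0" using a by simp
    show "norm (pv_regularized f c d a x) \<le> norm (\<bar>f x\<bar> / ?m + \<bar>B\<bar> * indicator {c..d} x)"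
    proof (cases "x \<in> {c..d}")
      case True
      have "\<bar>f x - f a\<bar> \<le> \<bar>B\<bar> * \<bar>x - a\<bar>"
        using lip[OF True] mult_right_mono[of B "\<bar>B\<bar>" "\<bar>x - a\<bar>"] by linarith
      \<comment> \<open>At \<open>x = a\<close> the quotient is 0 by the convention for division by
        zero.\<close>
      then have "\<bar>(f x - f a) / (x - a)\<bar> \<le> \<bar>B\<bar>"
        by (cases "x = a") (auto simp: abs_divide divide_le_eq)
      moreover have "\<bar>f x\<bar> / ?m \<ge> 0" using m by (meson abs_ge_zero divide_nonneg_pos)
      ultimately show ?thesis using True by (simp add: pv_regularized_def)
    next
      case False
      then have "\<bar>x - a\<bar> \<ge> ?m" using a by auto
      then have "\<bar>f x\<bar> / \<bar>x - a\<bar> \<le> \<bar>f x\<bar> / ?m"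
        using m by (intro divide_left_mono mult_pos_pos) auto
      then show ?thesis
        using False abs_of_pos[OF m] by (simp add: pv_regularized_def abs_divide)
    qed
  qed
qed

text \<open>The contributions \<open>ln \<epsilon>\<close> from the two sides of the gap cancel, so
  the value is independent of \<open>\<epsilon>\<close>.\<close>

lemma set_integral_inverse_punctured:
  fixes a :: real
  assumes "0 < \<epsilon>" "c \<le> a - \<epsilon>" "a + \<epsilon> \<le> d"
  shows "set_integrable lborel (- {a - \<epsilon><..<a + \<epsilon>}) (\<lambda>x. indicator {c..d} x / (x - a))"
    and "(LINT x:- {a - \<epsilon><..<a + \<epsilon>}|lborel. indicator {c..d} x / (x - a)) = ln (d - a) - ln (a - c)"
proof -
  have r: "has_bochner_integral lborel (\<lambda>x. 1 / (x - a) * indicator {a + \<epsilon>..d} x) (ln (d - a) - ln (a + \<epsilon> - a))"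
    using assms by (intro has_bochner_integral_FTC_Icc_nonneg continuous_intros)
      (auto intro!: derivative_eq_intros continuous_intros simp: field_simps)
  \<comment> \<open>The sign is reversed on the left of \<open>a\<close> because this form of the
    fundamental theorem wants a nonnegative integrand.\<close>
  have l: "has_bochner_integral lborel (\<lambda>x. 1 / (a - x) * indicator {c..a - \<epsilon>} x) ((- ln (a - (a - \<epsilon>))) - (- ln (a - c)))"
    using assms by (intro has_bochner_integral_FTC_Icc_nonneg)
      (auto intro!: derivative_eq_intros continuous_intros simp: field_simps)
  have eq: "(\<lambda>x. 1 / (x - a) * indicator {a + \<epsilon>..d} x - 1 / (a - x) * indicator {c..a - \<epsilon>} x)
      = (\<lambda>x. indicator (- {a - \<epsilon><..<a + \<epsilon>}) x *\<^sub>R (indicator {c..d} x / (x - a)))"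
    using assms by (intro ext) (auto simp: indicator_def divide_simps)
  from has_bochner_integral_diff[OF r l]
  have "has_bochner_integral lborel (\<lambda>x. indicator (- {a - \<epsilon><..<a + \<epsilon>}) x *\<^sub>R (indicator {c..d} x / (x - a)))
      (ln (d - a) - ln (a - c))"
    unfolding eq by simp
  then show "set_integrable lborel (- {a - \<epsilon><..<a + \<epsilon>}) (\<lambda>x. indicator {c..d} x / (x - a))"
    and "(LINT x:- {a - \<epsilon><..<a + \<epsilon>}|lborel. indicator {c..d} x / (x - a)) = ln (d - a) - ln (a - c)"
    by (auto simp: set_integrable_def set_lebesgue_integral_def has_bochner_integral_iff)
qed

text \<open>Off the gap, f x / (x - a) is the regularized integrand plus \<open>f a\<close> times
  the truncated 1 / (x - a). The second part is constant once the gap lies in \<open>{c..d}\<close>,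
  and dominated convergence closes the gap in the first.\<close>

lemma pv_integral_eq:
  fixes f :: "real \<Rightarrow> real"
  assumes f: "integrable lborel f" and a: "c < a" "a < d"
    and lip: "\<And>x. x \<in> {c..d} \<Longrightarrow> \<bar>f x - f a\<bar> \<le> B * \<bar>x - a\<bar>"
  shows "pv_integral f a = (LINT x|lborel. pv_regularized f c d a x) + f a * (ln (d - a) - ln (a - c))"
proof -
  let ?g = "pv_regularized f c d a"
  let ?E = "\<lambda>\<epsilon>. - {a - \<epsilon><..<a + \<epsilon>}"
  have g: "integrable lborel ?g"
    using integrable_pv_regularized[OF assms] .
  have ev: "\<forall>\<^sub>F \<epsilon> in at_right 0. (LINT x:?E \<epsilon>|lborel. ?g x) + f a * (ln (d - a) - ln (a - c))
      = (LINT x:?E \<epsilon>|lborel. f x / (x - a))"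
  proof -
    have "\<forall>\<^sub>F \<epsilon>::real in at_right 0. 0 < \<epsilon> \<and> \<epsilon> < min (a - c) (d - a)"
      using a by (intro eventually_conj eventually_at_right_less eventually_at_rightI[of 0 "min (a - c) (d - a)"]) auto
    then show ?thesis
    proof eventually_elim
      case (elim \<epsilon>)
      note i = set_integral_inverse_punctured[of \<epsilon> c a d]
      have "(LINT x:?E \<epsilon>|lborel. f x / (x - a)) = (LINT x:?E \<epsilon>|lborel. ?g x + f a * (indicator {c..d} x / (x - a)))"
        by (intro set_lebesgue_integral_cong) (auto simp: pv_regularized_def add_divide_distrib[symmetric])
      also have "\<dots> = (LINT x:?E \<epsilon>|lborel. ?g x) + (LINT x:?E \<epsilon>|lborel. f a * (indicator {c..d} x / (x - a)))"
      proof (intro set_integral_add set_integrable_mult_right)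
        show "set_integrable lborel (?E \<epsilon>) ?g"
          unfolding set_integrable_def by (intro integrable_mult_indicator g) auto
        show "set_integrable lborel (?E \<epsilon>) (\<lambda>x. indicator {c..d} x / (x - a))"
          using elim by (intro i(1)) auto
      qed
      also have "\<dots> = (LINT x:?E \<epsilon>|lborel. ?g x) + f a * (ln (d - a) - ln (a - c))"
        unfolding set_integral_mult_right using elim i(2) by simp
      finally show ?case by simp
    qed
  qed
  have "((\<lambda>\<epsilon>. LINT x:?E \<epsilon>|lborel. ?g x) \<longlongrightarrow> (LINT x|lborel. ?g x)) (at_right 0)"
    unfolding tendsto_at_iff_sequentially
  proof (intro allI impI)
    fix X :: "nat \<Rightarrow> real" assume X: "\<forall>i. X i \<in> {0<..} - {0}" "X \<longlonglongrightarrow> 0"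
    have "(\<lambda>n. LINT x|lborel. indicator (?E (X n)) x *\<^sub>R ?g x) \<longlonglongrightarrow> (LINT x|lborel. ?g x)"
    proof (rule integral_dominated_convergence[where w = "\<lambda>x. norm (?g x)"])
      show "AE x in lborel. (\<lambda>n. indicator (?E (X n)) x *\<^sub>R ?g x) \<longlonglongrightarrow> ?g x"
      proof (rule AE_I2)
        fix x
        show "(\<lambda>n. indicator (?E (X n)) x *\<^sub>R ?g x) \<longlonglongrightarrow> ?g x"
        proof (cases "x = a")
          case True
          then show ?thesis by (simp add: pv_regularized_def)
        next
          case False
          then have "\<forall>\<^sub>F n in sequentially. X n < \<bar>x - a\<bar>"
            using X(2) by (intro order_tendstoD) auto
          then have "\<forall>\<^sub>F n in sequentially. ?g x = indicator (?E (X n)) x *\<^sub>R ?g x"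
            by eventually_elim (auto simp: indicator_def)
          then show ?thesis by (rule Lim_transform_eventually[OF tendsto_const])
        qed
      qed
    qed (use g in \<open>auto simp: indicator_def\<close>)
    then show "((\<lambda>\<epsilon>. LINT x:?E \<epsilon>|lborel. ?g x) \<circ> X) \<longlonglongrightarrow> (LINT x|lborel. ?g x)"
      by (simp add: o_def set_lebesgue_integral_def)
  qed
  then have "((\<lambda>\<epsilon>. (LINT x:?E \<epsilon>|lborel. ?g x) + f a * (ln (d - a) - ln (a - c)))
      \<longlongrightarrow> (LINT x|lborel. ?g x) + f a * (ln (d - a) - ln (a - c))) (at_right 0)"
    by (intro tendsto_intros)
  from Lim_transform_eventually[OF this ev] show ?thesis
    unfolding pv_integral_def by (intro tendsto_Lim) auto
qed


section \<open>Difference quotients of the principal value at a double zero\<close>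

lemma abs_ln_diff_le:
  fixes s t r :: real
  assumes "0 < r" "r \<le> s" "r \<le> t"
  shows "\<bar>ln s - ln t\<bar> \<le> \<bar>s - t\<bar> / r"
proof -
  have le: "ln s - ln t \<le> \<bar>s - t\<bar> / r" if "r \<le> s" "r \<le> t" for s t
  proof -
    have "ln s - ln t \<le> (s - t) / t"
      using that assms by (intro ln_diff_le) auto
    also have "\<dots> \<le> \<bar>s - t\<bar> / t"
      using that assms by (intro divide_right_mono) auto
    also have "\<dots> \<le> \<bar>s - t\<bar> / r"
      using that assms by (intro divide_left_mono) auto
    finally show ?thesis .
  qed
  show ?thesis
    using le[of s t] le[of t s] assms by (simp add: abs_le_iff abs_minus_commute)
qed

text \<open>The window has radius \<open>2 * r\<close> so that base points within \<open>r\<close>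
  of \<open>z\<close> keep distance at least \<open>r\<close> from its ends. This controls both the
  logarithms and the part of the integrand outside the window.\<close>

locale double_zero =
  fixes f p :: "real \<Rightarrow> real" and z r C :: real
  assumes f_integrable: "integrable lborel f"
    and r_pos: "r > 0"
    and deriv: "\<And>t. \<bar>t - z\<bar> \<le> 2 * r \<Longrightarrow> (f has_real_derivative p t) (at t)"
    and lipschitz: "\<And>s t. \<bar>s - z\<bar> \<le> 2 * r \<Longrightarrow> \<bar>t - z\<bar> \<le> 2 * r \<Longrightarrow> \<bar>p s - p t\<bar> \<le> C * \<bar>s - t\<bar>"
    and f_zero: "f z = 0" and p_zero: "p z = 0"
begin

lemma C_nonneg: "C \<ge> 0"
  using lipschitz[of "z + r" z] r_pos abs_ge_zero[of "p (z + r) - p z"]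
  by (simp add: zero_le_mult_iff) (smt (verit) mult_neg_pos)

text \<open>Since \<open>p\<close> vanishes at \<open>z\<close> and is Lipschitz, the slope between
  \<open>s\<close> and \<open>t\<close> is at most \<open>C\<close> times their combined distance
  from \<open>z\<close>. Hence difference quotients of \<open>f\<close> tend to 0 at
  \<open>z\<close>.\<close>

lemma diff_bound:
  assumes "\<bar>s - z\<bar> \<le> 2 * r" "\<bar>t - z\<bar> \<le> 2 * r"
  shows "\<bar>f s - f t\<bar> \<le> C * (\<bar>s - z\<bar> + \<bar>t - z\<bar>) * \<bar>s - t\<bar>"
proof -
  have le: "\<bar>f t - f s\<bar> \<le> C * (\<bar>s - z\<bar> + \<bar>t - z\<bar>) * \<bar>t - s\<bar>"
    if st: "\<bar>s - z\<bar> \<le> 2 * r" "\<bar>t - z\<bar> \<le> 2 * r" "s < t" for s t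
  proof -
    have "\<exists>\<xi>. s < \<xi> \<and> \<xi> < t \<and> f t - f s = (t - s) * p \<xi>"
      using st by (intro MVT2 deriv) auto
    then obtain \<xi> where \<xi>: "s < \<xi>" "\<xi> < t" "f t - f s = (t - s) * p \<xi>" by blast
    have "\<bar>p \<xi>\<bar> \<le> C * \<bar>\<xi> - z\<bar>"
      using lipschitz[of \<xi> z] \<xi> st r_pos p_zero by auto
    also have "\<dots> \<le> C * (\<bar>s - z\<bar> + \<bar>t - z\<bar>)"
      using \<xi> C_nonneg by (intro mult_left_mono) auto
    finally have "\<bar>t - s\<bar> * \<bar>p \<xi>\<bar> \<le> \<bar>t - s\<bar> * (C * (\<bar>s - z\<bar> + \<bar>t - z\<bar>))"
      by (intro mult_left_mono) auto
    then show ?thesis unfolding \<xi>(3) by (simp add: abs_mult ac_simps)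
  qed
  consider "s < t" | "s = t" | "t < s" by linarith
  then show ?thesis
    using le[of s t] le[of t s] assms by cases (auto simp: abs_minus_commute add.commute)
qed

lemma pv_eq:
  assumes "\<bar>a - z\<bar> \<le> r"
  shows "pv_integral f a = (LINT x|lborel. pv_regularized f (z - 2 * r) (z + 2 * r) a x)
      + f a * (ln (z + 2 * r - a) - ln (a - (z - 2 * r)))"
    and "integrable lborel (pv_regularized f (z - 2 * r) (z + 2 * r) a)"
proof -
  have a: "z - 2 * r < a" "a < z + 2 * r" using assms r_pos by auto
  have b: "\<bar>f x - f a\<bar> \<le> C * (2 * r + 2 * r) * \<bar>x - a\<bar>" if "x \<in> {z - 2 * r..z + 2 * r}" for x
  proof -
    have "\<bar>f x - f a\<bar> \<le> C * (\<bar>x - z\<bar> + \<bar>a - z\<bar>) * \<bar>x - a\<bar>"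
      using that assms r_pos by (intro diff_bound) auto
    also have "\<dots> \<le> C * (2 * r + 2 * r) * \<bar>x - a\<bar>"
      using that assms r_pos C_nonneg by (intro mult_right_mono mult_left_mono add_mono) auto
    finally show ?thesis .
  qed
  show "pv_integral f a = (LINT x|lborel. pv_regularized f (z - 2 * r) (z + 2 * r) a x)
      + f a * (ln (z + 2 * r - a) - ln (a - (z - 2 * r)))"
    by (rule pv_integral_eq[OF f_integrable a b])
  show "integrable lborel (pv_regularized f (z - 2 * r) (z + 2 * r) a)"
    by (rule integrable_pv_regularized[OF f_integrable a b])
qed

text \<open>At a double zero the integrand \<open>f x / (x - z)\<^sup>2\<close> of the formal derivative of the principal
  value is not singular, and no regularization is left in the limit.\<close>

lemma pv_difference_quotient:
  assumes X: "X \<longlonglongrightarrow> z" "\<And>n. \<bar>X n - z\<bar> \<le> r" and Y: "Y \<longlonglongrightarrow> z" "\<And>n. \<bar>Y n - z\<bar> \<le> r"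
    and ne: "\<And>n. X n \<noteq> Y n"
  shows "integrable lborel (\<lambda>x. f x / (x - z)\<^sup>2)"
    and "(\<lambda>n. (pv_integral f (X n) - pv_integral f (Y n)) / (X n - Y n))
      \<longlonglongrightarrow> (LINT x|lborel. f x / (x - z)\<^sup>2)"
proof -
  let ?I = "{z - 2 * r..z + 2 * r}"
  let ?g = "pv_regularized f (z - 2 * r) (z + 2 * r)"
  let ?l = "\<lambda>a. ln (z + 2 * r - a) - ln (a - (z - 2 * r))"
  \<comment> \<open>The difference quotient of the regularized integrand with respect to its base
    point; its limit under the integral is the derivative sought.\<close>
  define s where "s n x = (?g (X n) x - ?g (Y n) x) / (X n - Y n)" for n x
  have [measurable]: "f \<in> borel_measurable borel" using f_integrable by auto
  have s_meas: "s n \<in> borel_measurable lborel" for n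
    unfolding s_def pv_regularized_def by measurable
  have dist0: "(\<lambda>n. \<bar>X n - z\<bar> + \<bar>Y n - z\<bar>) \<longlonglongrightarrow> \<bar>z - z\<bar> + \<bar>z - z\<bar>"
    by (intro tendsto_intros X Y)
  have Xb: "\<bar>X n - z\<bar> \<le> 2 * r" and Yb: "\<bar>Y n - z\<bar> \<le> 2 * r" for n
    using X(2)[of n] Y(2)[of n] r_pos by linarith+
  have q0: "(\<lambda>n. (f (X n) - f (Y n)) / (X n - Y n)) \<longlonglongrightarrow> 0"
  proof (rule Lim_null_comparison)
    show "\<forall>\<^sub>F n in sequentially. norm ((f (X n) - f (Y n)) / (X n - Y n)) \<le> C * (\<bar>X n - z\<bar> + \<bar>Y n - z\<bar>)"
      using diff_bound[OF Xb Yb] ne by (auto simp: abs_divide divide_le_eq intro!: always_eventually)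
    show "(\<lambda>n. C * (\<bar>X n - z\<bar> + \<bar>Y n - z\<bar>)) \<longlonglongrightarrow> 0"
      using tendsto_mult_left[OF dist0, of C] by simp
  qed
  have f_lim: "(\<lambda>n. f (U n)) \<longlonglongrightarrow> 0" if "U \<longlonglongrightarrow> z" for U
    using isCont_tendsto_compose[OF DERIV_isCont[OF deriv] that] r_pos f_zero by simp
  \<comment> \<open>Inside the window this is a second divided difference of \<open>f\<close>, hence
    bounded by \<open>C\<close>.\<close>
  have s_in: "s n x = ((f x - f (X n)) / (x - X n) - (f (X n) - f (Y n)) / (X n - Y n)) / (x - Y n)"
    if "x \<in> ?I" "x \<noteq> X n" "x \<noteq> Y n" for n x
  proof -
    have nz: "x - X n \<noteq> 0" "x - Y n \<noteq> 0" "X n - Y n \<noteq> 0" using that ne by auto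
    have "s n x = ((f x - f (X n)) / (x - X n) - (f x - f (Y n)) / (x - Y n)) / (X n - Y n)"
      using that by (simp add: s_def pv_regularized_def)
    also have "\<dots> = ((f x - f (X n)) / (x - X n) - (f (X n) - f (Y n)) / (X n - Y n)) / (x - Y n)"
      using nz by (simp add: divide_simps) (simp add: algebra_simps)
    finally show ?thesis .
  qed
  have s_out: "s n x = f x / ((x - X n) * (x - Y n))" if "x \<notin> ?I" for n x
  proof -
    have nz: "x - X n \<noteq> 0" "x - Y n \<noteq> 0" "X n - Y n \<noteq> 0"
      using that ne Xb[of n] Yb[of n] by auto
    have "s n x = (f x / (x - X n) - f x / (x - Y n)) / (X n - Y n)"
      using that by (simp add: s_def pv_regularized_def)
    also have "\<dots> = f x / ((x - X n) * (x - Y n))"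
      using nz by (simp add: divide_simps) (simp add: algebra_simps)
    finally show ?thesis .
  qed
  \<comment> \<open>The majorant is \<open>C\<close> on the window; outside, both factors of the
    denominator are at least \<open>r\<close> in modulus. The two base points are excluded as a null
    set.\<close>
  have s_bound: "AE x in lborel. norm (s n x) \<le> C * indicator ?I x + \<bar>f x\<bar> / r\<^sup>2" for n
    using AE_lborel_singleton[of "X n"] AE_lborel_singleton[of "Y n"]
  proof eventually_elim
    case (elim x)
    show ?case
    proof (cases "x \<in> ?I")
      case True
      have "\<bar>s n x\<bar> \<le> C"
        unfolding s_in[OF True elim]
      proof (rule divided_difference_bound)
        fix t assume "t \<in> ?I"
        then show "(f has_real_derivative p t) (at t)" by (intro deriv) auto
      next
        fix v w assume "v \<in> ?I" "w \<in> ?I"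
        then show "\<bar>p v - p w\<bar> \<le> C * \<bar>v - w\<bar>" by (intro lipschitz) auto
      qed (use True elim ne Xb[of n] Yb[of n] in auto)
      then show ?thesis using True by (simp add: add_increasing2)
    next
      case False
      have "r \<le> \<bar>x - X n\<bar>" "r \<le> \<bar>x - Y n\<bar>"
        using False X(2)[of n] Y(2)[of n] by auto
      then have "r * r \<le> \<bar>x - X n\<bar> * \<bar>x - Y n\<bar>"
        using r_pos by (intro mult_mono) auto
      then have "\<bar>f x\<bar> / (\<bar>x - X n\<bar> * \<bar>x - Y n\<bar>) \<le> \<bar>f x\<bar> / (r * r)"
        using r_pos less_le_trans[of 0 "r * r" "\<bar>x - X n\<bar> * \<bar>x - Y n\<bar>"]
        by (intro divide_left_mono) auto
      then show ?thesis
        unfolding s_out[OF False] using False by (simp add: abs_divide abs_mult power2_eq_square)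
    qed
  qed
  have s_lim: "AE x in lborel. (\<lambda>n. s n x) \<longlonglongrightarrow> f x / (x - z)\<^sup>2"
    using AE_lborel_singleton[of z]
  proof eventually_elim
    case (elim x)
    have lim1: "(\<lambda>n. x - X n) \<longlonglongrightarrow> x - z" "(\<lambda>n. x - Y n) \<longlonglongrightarrow> x - z"
      by (intro tendsto_intros X Y)+
    have nz: "x - z \<noteq> 0" using elim by simp
    show ?case
    proof (cases "x \<in> ?I")
      case True
      have "(\<lambda>n. ((f x - f (X n)) / (x - X n) - (f (X n) - f (Y n)) / (X n - Y n)) / (x - Y n))
          \<longlonglongrightarrow> ((f x - 0) / (x - z) - 0) / (x - z)"
        by (intro tendsto_divide tendsto_diff tendsto_const lim1 nz q0 f_lim X)
      then have lim: "(\<lambda>n. ((f x - f (X n)) / (x - X n) - (f (X n) - f (Y n)) / (X n - Y n)) / (x - Y n))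
          \<longlonglongrightarrow> f x / (x - z)\<^sup>2"
        by (simp add: power2_eq_square)
      have "\<forall>\<^sub>F n in sequentially. X n \<noteq> x" "\<forall>\<^sub>F n in sequentially. Y n \<noteq> x"
        using tendsto_imp_eventually_ne[OF X(1), of x] tendsto_imp_eventually_ne[OF Y(1), of x] elim by auto
      then have "\<forall>\<^sub>F n in sequentially.
          ((f x - f (X n)) / (x - X n) - (f (X n) - f (Y n)) / (X n - Y n)) / (x - Y n) = s n x"
        by eventually_elim (use s_in[OF True] in metis)
      with lim show ?thesis by (rule Lim_transform_eventually)
    next
      case False
      have "(\<lambda>n. f x / ((x - X n) * (x - Y n))) \<longlonglongrightarrow> f x / ((x - z) * (x - z))"
        using nz by (intro tendsto_intros lim1) auto
      then show ?thesis by (simp add: s_out[OF False] power2_eq_square)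
    qed
  qed
  have w: "integrable lborel (\<lambda>x. C * indicator ?I x + \<bar>f x\<bar> / r\<^sup>2)"
  proof (intro Bochner_Integration.integrable_add integrable_mult_right integrable_divide)
    show "integrable lborel (\<lambda>x. \<bar>f x\<bar>)"
      using f_integrable by simp
    show "integrable lborel (indicat_real ?I)"
      by (rule integrable_real_indicator) (auto simp: emeasure_lborel_Icc_eq)
  qed
  have lim_meas: "(\<lambda>x. f x / (x - z)\<^sup>2) \<in> borel_measurable lborel"
    by measurable
  note dct = integral_dominated_convergence[OF lim_meas s_meas w s_lim s_bound]
    integrable_dominated_convergence[OF lim_meas s_meas w s_lim s_bound]
  show "integrable lborel (\<lambda>x. f x / (x - z)\<^sup>2)"
    by (rule dct)
  have int_s: "(LINT x|lborel. s n x) = ((LINT x|lborel. ?g (X n) x) - (LINT x|lborel. ?g (Y n) x)) / (X n - Y n)" for n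
    unfolding s_def using pv_eq(2)[OF X(2)] pv_eq(2)[OF Y(2)] by simp
  have l_lim: "(\<lambda>n. ?l (X n)) \<longlonglongrightarrow> ?l z"
    using r_pos by (intro tendsto_intros X) auto
  \<comment> \<open>Each logarithm has Lipschitz constant \<open>1 / r\<close> here, and the factor
    \<open>f (Y n)\<close> tends to 0.\<close>
  have l_quot: "(\<lambda>n. f (Y n) * ((?l (X n) - ?l (Y n)) / (X n - Y n))) \<longlonglongrightarrow> 0"
  proof (rule Lim_null_comparison)
    show "\<forall>\<^sub>F n in sequentially. norm (f (Y n) * ((?l (X n) - ?l (Y n)) / (X n - Y n))) \<le> \<bar>f (Y n)\<bar> * (2 / r)"
    proof (intro always_eventually allI)
      fix n
      have "\<bar>ln (z + 2 * r - X n) - ln (z + 2 * r - Y n)\<bar> \<le> \<bar>(z + 2 * r - X n) - (z + 2 * r - Y n)\<bar> / r"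
        using X(2)[of n] Y(2)[of n] r_pos by (intro abs_ln_diff_le) auto
      moreover have "\<bar>ln (X n - (z - 2 * r)) - ln (Y n - (z - 2 * r))\<bar> \<le> \<bar>(X n - (z - 2 * r)) - (Y n - (z - 2 * r))\<bar> / r"
        using X(2)[of n] Y(2)[of n] r_pos by (intro abs_ln_diff_le) auto
      ultimately have "\<bar>?l (X n) - ?l (Y n)\<bar> \<le> 2 / r * \<bar>X n - Y n\<bar>"
        by (simp add: abs_minus_commute)
      then have "\<bar>(?l (X n) - ?l (Y n)) / (X n - Y n)\<bar> \<le> 2 / r"
        unfolding abs_divide using ne[of n] by (subst pos_divide_le_eq) auto
      then show "norm (f (Y n) * ((?l (X n) - ?l (Y n)) / (X n - Y n))) \<le> \<bar>f (Y n)\<bar> * (2 / r)"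
        unfolding real_norm_def abs_mult by (intro mult_left_mono) auto
    qed
    show "(\<lambda>n. \<bar>f (Y n)\<bar> * (2 / r)) \<longlonglongrightarrow> 0"
      using tendsto_mult_right[OF tendsto_rabs[OF f_lim[OF Y(1)]], of "2 / r"] by simp
  qed
  have "(\<lambda>n. (LINT x|lborel. s n x) + (f (X n) - f (Y n)) / (X n - Y n) * ?l (X n)
        + f (Y n) * ((?l (X n) - ?l (Y n)) / (X n - Y n)))
      \<longlonglongrightarrow> (LINT x|lborel. f x / (x - z)\<^sup>2) + 0 * ?l z + 0"
    by (intro tendsto_add tendsto_mult dct(1) q0 l_lim l_quot)
  moreover have "(LINT x|lborel. s n x) + (f (X n) - f (Y n)) / (X n - Y n) * ?l (X n)
        + f (Y n) * ((?l (X n) - ?l (Y n)) / (X n - Y n))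
      = (pv_integral f (X n) - pv_integral f (Y n)) / (X n - Y n)" for n
    unfolding pv_eq(1)[OF X(2)] pv_eq(1)[OF Y(2)] int_s
    by (simp add: add_divide_distrib[symmetric]) (simp add: algebra_simps)
  ultimately show "(\<lambda>n. (pv_integral f (X n) - pv_integral f (Y n)) / (X n - Y n))
      \<longlonglongrightarrow> (LINT x|lborel. f x / (x - z)\<^sup>2)"
    by simp
qed

end

text \<open>The displacement is comparable to \<open>f (A n)\<close>, while the slopes of
  \<open>f\<close> near \<open>z\<close> tend to 0, so \<open>f\<close> changes by a negligible
  fraction of itself. The principal value changes by its derivative at \<open>z\<close> times the
  displacement.\<close>

lemma (in double_zero) perturbed_argument:
  fixes k :: real
  assumes A: "A \<longlonglongrightarrow> z" and nz: "\<And>n. f (A n) \<noteq> 0"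
  defines "B \<equiv> \<lambda>n. A n + k * f (A n)"
  shows "B \<longlonglongrightarrow> z" "(\<lambda>n. f (B n) / f (A n)) \<longlonglongrightarrow> 1"
    and "(\<lambda>n. (pv_integral f (B n) - pv_integral f (A n)) / f (A n))
      \<longlonglongrightarrow> k * (LINT x|lborel. f x / (x - z)\<^sup>2)"
proof -
  have fA: "(\<lambda>n. f (A n)) \<longlonglongrightarrow> 0"
    using isCont_tendsto_compose[OF DERIV_isCont[OF deriv] A] r_pos f_zero by simp
  have "(\<lambda>n. A n + k * f (A n)) \<longlonglongrightarrow> z + k * 0"
    by (intro tendsto_intros A fA)
  then show B: "B \<longlonglongrightarrow> z" by (simp add: B_def)
  have near: "\<forall>\<^sub>F n in sequentially. \<bar>U n - z\<bar> \<le> r" if "U \<longlonglongrightarrow> z" for U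
    using tendstoD[OF that r_pos] by eventually_elim (simp add: dist_real_def)
  have dist0: "(\<lambda>n. \<bar>B n - z\<bar> + \<bar>A n - z\<bar>) \<longlonglongrightarrow> \<bar>z - z\<bar> + \<bar>z - z\<bar>"
    by (intro tendsto_intros A B)
  have "(\<lambda>n. f (B n) / f (A n) - 1) \<longlonglongrightarrow> 0"
  proof (rule Lim_null_comparison)
    show "\<forall>\<^sub>F n in sequentially. norm (f (B n) / f (A n) - 1) \<le> C * (\<bar>B n - z\<bar> + \<bar>A n - z\<bar>) * \<bar>k\<bar>"
      using near[OF A] near[OF B]
    proof eventually_elim
      case (elim n)
      have "f (B n) / f (A n) - 1 = (f (B n) - f (A n)) / f (A n)"
        using nz by (simp add: diff_divide_distrib)
      moreover have "\<bar>f (B n) - f (A n)\<bar> \<le> C * (\<bar>B n - z\<bar> + \<bar>A n - z\<bar>) * \<bar>B n - A n\<bar>"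
        using elim r_pos by (intro diff_bound) auto
      then have "\<bar>f (B n) - f (A n)\<bar> \<le> (C * (\<bar>B n - z\<bar> + \<bar>A n - z\<bar>) * \<bar>k\<bar>) * \<bar>f (A n)\<bar>"
        by (simp add: B_def abs_mult mult.assoc)
      ultimately show ?case
        using nz by (simp add: abs_divide pos_divide_le_eq)
    qed
    show "(\<lambda>n. C * (\<bar>B n - z\<bar> + \<bar>A n - z\<bar>) * \<bar>k\<bar>) \<longlonglongrightarrow> 0"
      using tendsto_mult_right[OF tendsto_mult_left[OF dist0, of C], of "\<bar>k\<bar>"] by simp
  qed
  then show "(\<lambda>n. f (B n) / f (A n)) \<longlonglongrightarrow> 1" by (rule LIM_zero_cancel)
  show "(\<lambda>n. (pv_integral f (B n) - pv_integral f (A n)) / f (A n))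
      \<longlonglongrightarrow> k * (LINT x|lborel. f x / (x - z)\<^sup>2)"
  \<comment> \<open>For \<open>k = 0\<close> the two arguments coincide and there is no difference
    quotient to take.\<close>
  proof (cases "k = 0")
    case True
    then show ?thesis by (simp add: B_def)
  next
    case False
    obtain N where N: "\<And>n. n \<ge> N \<Longrightarrow> \<bar>A n - z\<bar> \<le> r" "\<And>n. n \<ge> N \<Longrightarrow> \<bar>B n - z\<bar> \<le> r"
      using eventually_conj[OF near[OF A] near[OF B]] unfolding eventually_sequentially by blast
    have "(\<lambda>n. (pv_integral f (B (n + N)) - pv_integral f (A (n + N))) / (B (n + N) - A (n + N)))
        \<longlonglongrightarrow> (LINT x|lborel. f x / (x - z)\<^sup>2)"
      using N nz False
      by (intro pv_difference_quotient LIMSEQ_ignore_initial_segment A B) (auto simp: B_def)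
    then have "(\<lambda>n. (pv_integral f (B n) - pv_integral f (A n)) / (B n - A n))
        \<longlonglongrightarrow> (LINT x|lborel. f x / (x - z)\<^sup>2)"
      by (rule LIMSEQ_offset)
    from tendsto_mult_left[OF this, of k] show ?thesis
      using False by (simp add: B_def)
  qed
qed

section \<open>The resonance limit\<close>

lemma bracket_eq: "\<mu> > 0 \<Longrightarrow> bracket V \<mu> = (l2_norm S2 (V \<mu>))\<^sup>2"
  by (simp add: bracket_def l2_inner_self)

text \<open>Two applications of the product rule give a continuous second derivative
  \<open>q\<close> of the bracket on the half-line; its bound on a compact interval is the Lipschitz
  constant of \<open>p\<close>. Each term of \<open>p z\<close> pairs something with
  \<open>V z\<close>, which is zero.\<close>

lemma smooth_rapid_double_zero:
  assumes V: "smooth_rapid V" and z: "z > 0" and Vz: "AE \<omega> in S2. V z \<omega> = 0"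
  obtains p r C where "double_zero (bracket V) p z r C"
proof -
  obtain D where D0: "D 0 = V" and D: "\<And>n \<mu>. \<mu> > 0 \<Longrightarrow> has_strong_derivative (D n) (D (Suc n) \<mu>) \<mu>"
    using V unfolding smooth_rapid_def by blast
  have l2D: "l2 S2 (D n \<mu>)" if "\<mu> > 0" for n \<mu>
    using V that D[OF that] by (cases n) (auto simp: D0 smooth_rapid_def has_strong_derivative_def)
  let ?i = "\<lambda>m n \<mu>. Re (l2_inner S2 (D m \<mu>) (D n \<mu>))"
  have di: "(?i m n has_real_derivative ?i (Suc m) n \<mu> + ?i m (Suc n) \<mu>) (at \<mu>)" if "\<mu> > 0" for m n \<mu>
    using that by (intro has_derivative_Re_l2_inner D l2D)
  define p where "p \<mu> = ?i 1 0 \<mu> + ?i 0 1 \<mu>" for \<mu>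
  define q where "q \<mu> = (?i 2 0 \<mu> + ?i 1 1 \<mu>) + (?i 1 1 \<mu> + ?i 0 2 \<mu>)" for \<mu>
  have dp: "(p has_real_derivative q \<mu>) (at \<mu>)" if "\<mu> > 0" for \<mu>
    using DERIV_add[OF di[of \<mu> 1 0] di[of \<mu> 0 1]] that
    unfolding p_def q_def by (simp add: numeral_2_eq_2)
  have "isCont q \<mu>" if "\<mu> > 0" for \<mu>
    unfolding q_def using that by (intro continuous_intros DERIV_isCont[OF di])
  then have "continuous_on {z / 2..3 * z / 2} q"
    using z by (intro continuous_at_imp_continuous_on ballI) auto
  from compact_imp_bounded[OF compact_continuous_image[OF this compact_Icc]]
  obtain C where C: "\<And>t. t \<in> {z / 2..3 * z / 2} \<Longrightarrow> \<bar>q t\<bar> \<le> C"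
    unfolding bounded_iff by (metis (no_types) imageI real_norm_def)
  have db: "(bracket V has_real_derivative p t) (at t)" if "t > 0" for t
  proof (rule has_field_derivative_transform_within_open[where S = "{0<..}"])
    show "(?i 0 0 has_real_derivative p t) (at t)"
      using di[OF that, of 0 0] by (simp add: p_def)
  qed (use that in \<open>auto simp: bracket_def D0\<close>)
  \<comment> \<open>With radius \<open>z / 4\<close> the window is
    \<open>{z / 2..3 * z / 2}\<close>, which stays inside the half-line of positive
    energies.\<close>
  have "double_zero (bracket V) p z (z / 4) C"
  proof
    have "integrable lborel (\<lambda>\<mu>. indicator {0<..} \<mu> *\<^sub>R (l2_norm S2 (V \<mu>))\<^sup>2)"
      using V by (simp add: smooth_rapid_def set_integrable_def)
    moreover have "(\<lambda>\<mu>. indicator {0<..} \<mu> *\<^sub>R (l2_norm S2 (V \<mu>))\<^sup>2) = bracket V"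
    proof
      fix \<mu> show "indicator {0<..} \<mu> *\<^sub>R (l2_norm S2 (V \<mu>))\<^sup>2 = bracket V \<mu>"
        by (cases "\<mu> > 0") (simp_all add: bracket_eq, simp add: bracket_def)
    qed
    ultimately show "integrable lborel (bracket V)" by simp
    show "z / 4 > 0" using z by simp
    show "(bracket V has_real_derivative p t) (at t)" if "\<bar>t - z\<bar> \<le> 2 * (z / 4)" for t
      using that z by (intro db) linarith
    show "\<bar>p s - p t\<bar> \<le> C * \<bar>s - t\<bar>" if "\<bar>s - z\<bar> \<le> 2 * (z / 4)" "\<bar>t - z\<bar> \<le> 2 * (z / 4)" for s t
    proof -
      have "norm (p s - p t) \<le> C * norm (s - t)"
      proof (rule field_differentiable_bound[where S = "{z / 2..3 * z / 2}"])
        fix v assume "v \<in> {z / 2..3 * z / 2}"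
        then show "(p has_real_derivative q v) (at v within {z / 2..3 * z / 2})" "norm (q v) \<le> C"
          using z C by (auto intro!: has_field_derivative_at_within dp)
      next
        show "s \<in> {z / 2..3 * z / 2}" "t \<in> {z / 2..3 * z / 2}"
          unfolding atLeastAtMost_iff using that by linarith+
      qed simp
      then show ?thesis by simp
    qed
    have null: "l2_inner S2 (V z) w = 0" "l2_inner S2 w (V z) = 0" for w
      unfolding l2_inner_def using Vz by (auto intro!: integral_eq_zero_AE)
    show "bracket V z = 0" "p z = 0"
      using z by (simp_all add: bracket_def p_def D0 null)
  qed
  then show ?thesis by (rule that)
qed

text \<open>Away from \<open>z\<close> the squared fibre norm is the integrand on the right, and the
  single energy \<open>z\<close> has measure zero.\<close>

lemma spec_norm_phi:
  assumes "bracket V \<in> borel_measurable borel" "z > 0"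
  shows "(spec_norm (phi V V' z))\<^sup>2 = (LINT x|lborel. bracket V x / (x - z)\<^sup>2)"
proof -
  have "(spec_norm (phi V V' z))\<^sup>2 = (LINT x|lborel. indicator {0<..} x *\<^sub>R (l2_norm S2 (phi V V' z x))\<^sup>2)"
    by (simp add: spec_norm_def set_lebesgue_integral_def)
  also have "(\<lambda>x. indicator {0<..} x *\<^sub>R (l2_norm S2 (phi V V' z x))\<^sup>2)
      = (\<lambda>x. if x = z then (l2_norm S2 V')\<^sup>2 else bracket V x / (x - z)\<^sup>2)"
  proof
    fix x
    have "l2_norm S2 (\<lambda>\<omega>. V x \<omega> / complex_of_real (x - z)) = l2_norm S2 (V x) / \<bar>x - z\<bar>"
      using l2_norm_cmult[of S2 "inverse (complex_of_real (x - z))" "V x"]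
      by (simp add: divide_inverse mult.commute norm_inverse del: of_real_diff)
    then show "indicator {0<..} x *\<^sub>R (l2_norm S2 (phi V V' z x))\<^sup>2
        = (if x = z then (l2_norm S2 V')\<^sup>2 else bracket V x / (x - z)\<^sup>2)"
      using \<open>z > 0\<close> by (cases "x > 0") (auto simp: phi_def bracket_eq power_divide, simp add: bracket_def)
  qed
  also have "(LINT x|lborel. (if x = z then (l2_norm S2 V')\<^sup>2 else bracket V x / (x - z)\<^sup>2))
      = (LINT x|lborel. bracket V x / (x - z)\<^sup>2)"
  proof (rule integral_cong_AE)
    show "AE x in lborel. (if x = z then (l2_norm S2 V')\<^sup>2 else bracket V x / (x - z)\<^sup>2)
        = bracket V x / (x - z)\<^sup>2"
      using AE_lborel_singleton[of z] by eventually_elim simp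
  qed (use assms in auto)
  finally show ?thesis .
qed

text \<open>A zero integral of this nonnegative function would make the bracket vanish almost
  everywhere on the interval from \<open>z\<close> to \<open>z + 1\<close>.\<close>

lemma integral_bracket_pos:
  assumes int: "integrable lborel (\<lambda>x. bracket V x / (x - z)\<^sup>2)"
    and pos: "\<And>x. x > z \<Longrightarrow> bracket V x \<noteq> 0"
  shows "(LINT x|lborel. bracket V x / (x - z)\<^sup>2) > 0"
proof -
  have nonneg: "bracket V x / (x - z)\<^sup>2 \<ge> 0" for x
    by (cases "x > 0") (simp_all add: bracket_eq, simp add: bracket_def)
  have "(LINT x|lborel. bracket V x / (x - z)\<^sup>2) \<noteq> 0"
  proof
    assume "(LINT x|lborel. bracket V x / (x - z)\<^sup>2) = 0"
    then have "AE x in lborel. bracket V x / (x - z)\<^sup>2 = 0"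
      using integral_nonneg_eq_0_iff_AE[OF int] nonneg by auto
    then have "AE x in lborel. x \<notin> {z<..<z + 1}"
      by eventually_elim (use pos in force)
    then have "{z<..<z + 1} \<in> null_sets lborel"
      by (subst AE_iff_null_sets) auto
    then show False by (simp add: null_sets_def)
  qed
  moreover have "(LINT x|lborel. bracket V x / (x - z)\<^sup>2) \<ge> 0"
    by (intro Bochner_Integration.integral_nonneg nonneg)
  ultimately show ?thesis by simp
qed

section \<open>Almost everywhere limits and extraction of sequences\<close>

lemma AE_pair_measure_fst:
  assumes "sigma_finite_measure N" "AE x in M. P x"
  shows "AE (x, y) in M \<Otimes>\<^sub>M N. P x"
proof -
  interpret sigma_finite_measure N by fact
  obtain Z where Z: "Z \<in> null_sets M" "{x \<in> space M. \<not> P x} \<subseteq> Z"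
    using assms(2) by (auto simp: eventually_ae_filter)
  have "Z \<times> space N \<in> null_sets (M \<Otimes>\<^sub>M N)"
    using Z(1) by (auto simp: null_sets_def emeasure_pair_measure_Times)
  then show ?thesis
    using Z(2) by (intro AE_I'[of "Z \<times> space N"]) (auto simp: space_pair_measure)
qed

text \<open>The squared errors converge to 0 in mean, and convergence in mean gives convergence
  almost everywhere along a subsequence.\<close>

lemma l2_limit_AE_subseq:
  assumes U: "\<And>n. l2 M (U n)" and v: "l2 M v"
    and lim: "(\<lambda>n. l2_norm M (\<lambda>x. U n x - v x)) \<longlonglongrightarrow> 0"
  obtains s :: "nat \<Rightarrow> nat" where "strict_mono s" "AE x in M. (\<lambda>n. U (s n) x) \<longlonglongrightarrow> v x"
proof -
  let ?d = "\<lambda>n x. (cmod (U n x - v x))\<^sup>2"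
  have "integrable M (?d n)" for n
    using l2_diff[OF U v] by (simp add: l2_def)
  moreover have "(\<lambda>n. LINT x|M. norm (?d n x)) \<longlonglongrightarrow> 0"
    using tendsto_power[OF lim, of 2] by (simp add: l2_norm_power2)
  ultimately obtain s :: "nat \<Rightarrow> nat"
    where s: "strict_mono s" "AE x in M. (\<lambda>n. ?d (s n) x) \<longlonglongrightarrow> 0"
    using tendsto_L1_AE_subseq[of M ?d] by blast
  from s(2) have "AE x in M. (\<lambda>n. U (s n) x) \<longlonglongrightarrow> v x"
  proof eventually_elim
    case (elim x)
    have "(\<lambda>n. sqrt (?d (s n) x)) \<longlonglongrightarrow> sqrt 0"
      by (intro tendsto_real_sqrt elim)
    then have "(\<lambda>n. norm (U (s n) x - v x)) \<longlonglongrightarrow> 0" by simp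
    then show ?case using LIM_zero_cancel tendsto_norm_zero_iff by blast
  qed
  with s(1) show ?thesis by (rule that)
qed

lemma eventually_at_sequence:
  fixes a :: real
  assumes "\<forall>\<^sub>F x in at a. P x"
  obtains X :: "nat \<Rightarrow> real" where "\<And>n. P (X n)" "\<And>n. X n \<noteq> a" "X \<longlonglongrightarrow> a"
proof -
  obtain d where d: "d > 0" "\<And>x. x \<noteq> a \<Longrightarrow> dist x a < d \<Longrightarrow> P x"
    using assms unfolding eventually_at by auto
  define \<epsilon> where "\<epsilon> n = d / 2 / real (Suc n)" for n
  have "\<epsilon> \<longlonglongrightarrow> 0"
    unfolding \<epsilon>_def by (rule LIMSEQ_Suc[OF lim_const_over_n])
  from tendsto_add[OF tendsto_const this, of a] have "(\<lambda>n. a + \<epsilon> n) \<longlonglongrightarrow> a" by simp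
  moreover have "P (a + \<epsilon> n)" "a + \<epsilon> n \<noteq> a" for n
  proof -
    have "\<epsilon> n \<le> d / 2 / 1"
      unfolding \<epsilon>_def using d(1) by (intro divide_left_mono) auto
    then have "\<epsilon> n < d" using d(1) by simp
    moreover have "\<epsilon> n > 0" using d(1) by (simp add: \<epsilon>_def)
    ultimately show "P (a + \<epsilon> n)" "a + \<epsilon> n \<noteq> a"
      by (auto intro!: d(2) simp: dist_real_def)
  qed
  ultimately show ?thesis using that[of "\<lambda>n. a + \<epsilon> n"] by blast
qed

text \<open>\<open>G1\<close> vanishes at \<open>lam \<alpha>\<close>, so at the shifted energy \<open>\<gamma>\<close> changes by about
  \<open>h \<kappa> \<gamma>'(\<mu>0) = h \<pi> |||u|||\<^sup>2\<close>: this is the definition of \<open>\<kappa>\<close>, because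
  \<open>\<gamma>'(\<mu>0)\<close> is the squared norm of \<open>\<phi>\<close>.\<close>

lemma resonance_limit:
  fixes h :: real and u' :: "real^3 \<Rightarrow> complex"
  assumes "\<alpha>0 > 0" "\<mu>0 > 0" and rapid: "smooth_rapid ul"
    and zero: "\<And>\<mu>. \<mu> > 0 \<Longrightarrow> (AE \<omega> in S2. ul \<mu> \<omega> = 0) \<longleftrightarrow> \<mu> = \<mu>0"
    and G1_0: "1 + \<alpha>0 * pv_integral (bracket ul) \<mu>0 = 0"
    and J: "open J" "J \<subseteq> {0<..}" "\<alpha>0 \<in> J"
    and cont: "isCont lam \<alpha>0" and lam_pos: "\<And>\<alpha>. \<alpha> \<in> J \<Longrightarrow> lam \<alpha> > 0"
    and lam0: "lam \<alpha>0 = \<mu>0"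
    and G1_lam: "\<And>\<alpha>. \<alpha> \<in> J \<Longrightarrow> G1 ul \<alpha> (lam \<alpha>) = 0"
  defines "\<Lambda> \<equiv> lam_h ul u' \<mu>0 lam h"
  shows "(\<Lambda> \<longlongrightarrow> \<mu>0) (at \<alpha>0)" and "\<forall>\<^sub>F \<alpha> in at \<alpha>0. \<Lambda> \<alpha> \<noteq> \<mu>0"
    and "((\<lambda>\<alpha>. complex_of_real (\<alpha> * (l2_norm S2 (ul (\<Lambda> \<alpha>)))\<^sup>2) / G ul \<alpha> (\<Lambda> \<alpha>))
      \<longlongrightarrow> 1 / (complex_of_real pi * (complex_of_real h + \<i>))) (at \<alpha>0)"
proof -
  let ?f = "bracket ul" and ?\<gamma> = "pv_integral (bracket ul)"
  obtain p r C where "double_zero ?f p \<mu>0 r C"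
    using smooth_rapid_double_zero[OF rapid \<open>\<mu>0 > 0\<close>] zero[OF \<open>\<mu>0 > 0\<close>] by blast
  then interpret double_zero ?f p \<mu>0 r C .
  have f_meas: "?f \<in> borel_measurable borel"
    using f_integrable by auto
  have f_nz: "?f \<mu> \<noteq> 0" if "\<mu> > 0" "\<mu> \<noteq> \<mu>0" for \<mu>
    using that zero[of \<mu>] l2_norm_eq_0_iff[of S2 "ul \<mu>"] rapid
    by (simp add: bracket_eq smooth_rapid_def)
  define L where "L = (LINT x|lborel. ?f x / (x - \<mu>0)\<^sup>2)"
  \<comment> \<open>The squared norm of the vector in \<open>kappa\<close> is \<open>L\<close>, so
    the shift has the form treated in \<open>perturbed_argument\<close> with
    \<open>k = h * pi / L\<close>.\<close>
  have \<Lambda>: "\<Lambda> \<alpha> = lam \<alpha> + h * pi / L * ?f (lam \<alpha>)" if "\<alpha> \<in> J" for \<alpha>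
    using lam_pos[OF that]
    by (simp add: \<Lambda>_def lam_h_def kappa_def spec_norm_phi[OF f_meas \<open>\<mu>0 > 0\<close>] L_def bracket_eq)
  \<comment> \<open>At energy \<open>\<mu>0\<close> the equation \<open>G1 = 0\<close> is affine in
    the coupling with nonzero slope, so \<open>\<alpha>0\<close> is its only root.\<close>
  have lam_ne: "lam \<alpha> \<noteq> \<mu>0" if "\<alpha> \<in> J" "\<alpha> \<noteq> \<alpha>0" for \<alpha>
  proof
    assume "lam \<alpha> = \<mu>0"
    then have "1 + \<alpha> * ?\<gamma> \<mu>0 = 0"
      using G1_lam[OF that(1)] by (simp add: G1_def)
    with G1_0 have "\<alpha> * ?\<gamma> \<mu>0 = \<alpha>0 * ?\<gamma> \<mu>0"
      by linarith
    moreover have "?\<gamma> \<mu>0 \<noteq> 0" using G1_0 by auto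
    ultimately show False using that(2) by simp
  qed
  have main: "(\<lambda>n. \<Lambda> (X n)) \<longlonglongrightarrow> \<mu>0"
      "\<forall>\<^sub>F n in sequentially. \<Lambda> (X n) \<noteq> \<mu>0"
      "(\<lambda>n. complex_of_real (X n * (l2_norm S2 (ul (\<Lambda> (X n))))\<^sup>2) / G ul (X n) (\<Lambda> (X n)))
      \<longlonglongrightarrow> 1 / (complex_of_real pi * (complex_of_real h + \<i>))"
    if X: "\<And>n. X n \<in> J - {\<alpha>0}" "X \<longlonglongrightarrow> \<alpha>0" for X
  proof -
    let ?A = "\<lambda>n. lam (X n)" and ?B = "\<lambda>n. \<Lambda> (X n)"
    have XJ: "X n \<in> J" and Xpos: "X n > 0" for n using X(1)[of n] J(2) by auto
    have A: "?A \<longlonglongrightarrow> \<mu>0"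
      using isCont_tendsto_compose[OF cont X(2)] lam0 by simp
    have fA: "?f (?A n) \<noteq> 0" for n
      using X(1)[of n] lam_pos lam_ne by (intro f_nz) auto
    have B_eq: "?B n = ?A n + h * pi / L * ?f (?A n)" for n
      using \<Lambda>[OF XJ] .
    note lims = perturbed_argument[OF A fA, of "h * pi / L", folded B_eq L_def]
    show B: "?B \<longlonglongrightarrow> \<mu>0" by (rule lims(1))
    have B_pos: "\<forall>\<^sub>F n in sequentially. ?B n > 0"
      using order_tendstoD(1)[OF B \<open>\<mu>0 > 0\<close>] .
    have fB: "\<forall>\<^sub>F n in sequentially. ?f (?B n) / ?f (?A n) > 0"
      using order_tendstoD(1)[OF lims(2), of 0] by simp
    show "\<forall>\<^sub>F n in sequentially. ?B n \<noteq> \<mu>0"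
      using fB by eventually_elim (metis f_zero div_0 less_irrefl)
    \<comment> \<open>Integrability is a byproduct of the difference quotient, so any admissible
      pair of sequences yields it; here one is constant and the other is
      \<open>\<mu>0 + r / (n + 1)\<close>.\<close>
    have "integrable lborel (\<lambda>x. ?f x / (x - \<mu>0)\<^sup>2)"
    proof (rule pv_difference_quotient(1))
      show "(\<lambda>n. \<mu>0) \<longlonglongrightarrow> \<mu>0" by simp
      show "(\<lambda>n. \<mu>0 + r / real (Suc n)) \<longlonglongrightarrow> \<mu>0"
        using tendsto_add[OF tendsto_const LIMSEQ_Suc[OF lim_const_over_n[of r]], of \<mu>0] by simp
      show "\<bar>\<mu>0 + r / real (Suc n) - \<mu>0\<bar> \<le> r" for n
        using r_pos divide_left_mono[of 1 "real (Suc n)" r] by simp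
    qed (use r_pos in auto)
    then have L: "L > 0"
      unfolding L_def using \<open>\<mu>0 > 0\<close> by (intro integral_bracket_pos f_nz) auto
    let ?g = "\<lambda>n. (?\<gamma> (?B n) - ?\<gamma> (?A n)) / ?f (?A n)"
    let ?q = "\<lambda>n. ?f (?B n) / ?f (?A n)"
    \<comment> \<open>The factor \<open>L\<close> from the derivative cancels the one in
      \<open>h * pi / L\<close>.\<close>
    have g: "?g \<longlonglongrightarrow> h * pi"
      using lims(3) L by simp
    have nz: "complex_of_real (h * pi) + \<i> * complex_of_real (pi * 1) \<noteq> 0"
      by (simp add: complex_eq_iff)
    have "(\<lambda>n. complex_of_real (?q n) / (complex_of_real (?g n) + \<i> * complex_of_real (pi * ?q n)))
      \<longlonglongrightarrow> complex_of_real 1 / (complex_of_real (h * pi) + \<i> * complex_of_real (pi * 1))"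
      by (intro tendsto_divide tendsto_add tendsto_mult tendsto_of_real tendsto_const lims(2) g nz)
    \<comment> \<open>Numerator and denominator share the factor \<open>X n * ?f (?A n)\<close>. As
      \<open>G1\<close> vanishes at \<open>?A n\<close>, its value at \<open>?B n\<close> is
      \<open>X n\<close> times the increment of the principal value.\<close>
    moreover have "\<forall>\<^sub>F n in sequentially.
        complex_of_real (?q n) / (complex_of_real (?g n) + \<i> * complex_of_real (pi * ?q n))
        = complex_of_real (X n * (l2_norm S2 (ul (?B n)))\<^sup>2) / G ul (X n) (?B n)"
      using B_pos
    proof eventually_elim
      case (elim n)
      have fg: "?f (?A n) * ?g n = ?\<gamma> (?B n) - ?\<gamma> (?A n)"
        using fA[of n] by simp
      have "G1 ul (X n) (?B n) = G1 ul (X n) (?B n) - G1 ul (X n) (?A n)"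
        using G1_lam[OF XJ] by simp
      also have "\<dots> = X n * ?f (?A n) * ?g n"
        unfolding mult.assoc fg by (simp add: G1_def algebra_simps)
      finally have "G ul (X n) (?B n)
          = complex_of_real (X n * ?f (?A n)) * (complex_of_real (?g n) + \<i> * complex_of_real (pi * ?q n))"
        using fA[of n] elim by (simp add: G_def G2_def bracket_eq algebra_simps)
      moreover have "complex_of_real (X n * (l2_norm S2 (ul (?B n)))\<^sup>2)
          = complex_of_real (X n * ?f (?A n)) * complex_of_real (?q n)"
        using fA[of n] elim by (simp add: bracket_eq)
      moreover have "complex_of_real (X n * ?f (?A n)) \<noteq> 0"
        using fA[of n] Xpos[of n] by simp
      ultimately show ?case by (simp only: nonzero_mult_divide_mult_cancel_left not_False_eq_True)
    qed
    ultimately have "(\<lambda>n. complex_of_real (X n * (l2_norm S2 (ul (?B n)))\<^sup>2) / G ul (X n) (?B n))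
      \<longlonglongrightarrow> complex_of_real 1 / (complex_of_real (h * pi) + \<i> * complex_of_real (pi * 1))"
      by (rule Lim_transform_eventually)
    moreover have "complex_of_real (h * pi) + \<i> * complex_of_real (pi * 1)
        = complex_of_real pi * (complex_of_real h + \<i>)"
      by (simp add: distrib_left mult.commute)
    ultimately show "(\<lambda>n. complex_of_real (X n * (l2_norm S2 (ul (?B n)))\<^sup>2) / G ul (X n) (?B n))
      \<longlonglongrightarrow> 1 / (complex_of_real pi * (complex_of_real h + \<i>))"
      by (simp only: of_real_1)
  qed
  \<comment> \<open>As \<open>J\<close> is an open neighbourhood, limits at \<open>\<alpha>0\<close>
    may be tested on sequences in \<open>J - {\<alpha>0}\<close>.\<close>
  have at_J: "at \<alpha>0 = at \<alpha>0 within J"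
    by (rule at_within_open[OF J(3,1), symmetric])
  show "(\<Lambda> \<longlongrightarrow> \<mu>0) (at \<alpha>0)"
    unfolding at_J tendsto_at_iff_sequentially o_def using main(1) by blast
  show "((\<lambda>\<alpha>. complex_of_real (\<alpha> * (l2_norm S2 (ul (\<Lambda> \<alpha>)))\<^sup>2) / G ul \<alpha> (\<Lambda> \<alpha>))
      \<longlongrightarrow> 1 / (complex_of_real pi * (complex_of_real h + \<i>))) (at \<alpha>0)"
    unfolding at_J tendsto_at_iff_sequentially o_def using main(3) by blast
  have "eventually (\<lambda>\<alpha>. \<Lambda> \<alpha> \<noteq> \<mu>0) (at \<alpha>0 within J)"
    by (rule sequentially_imp_eventually_within) (use main(2) in blast)
  then show "\<forall>\<^sub>F \<alpha> in at \<alpha>0. \<Lambda> \<alpha> \<noteq> \<mu>0"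
    unfolding at_J .
qed

section \<open>Limits of the total cross-section and of the scattering amplitude\<close>

theorem corollary7p6:
  fixes \<alpha>0 \<mu>0 h :: real
    and u :: "real^3 \<Rightarrow> complex"
    and ul :: "real \<Rightarrow> real^3 \<Rightarrow> complex"
    and u' :: "real^3 \<Rightarrow> complex"
    and J :: "real set"
    and lam :: "real \<Rightarrow> real"
    and S :: "real \<Rightarrow> real \<Rightarrow> (real^3 \<Rightarrow> complex) \<Rightarrow> (real^3 \<Rightarrow> complex)"
    and K :: "real \<Rightarrow> real \<Rightarrow> real^3 \<Rightarrow> real^3 \<Rightarrow> complex"
    and e :: "nat \<Rightarrow> real^3 \<Rightarrow> complex"
  assumes "\<alpha>0 > 0" and "\<mu>0 > 0"
    and "l2 lborel u" and "is_spec_rep u ul" and "smooth_rapid ul"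
    and "l2_norm lborel u = 1"
    and "\<And>\<mu>. \<mu> > 0 \<Longrightarrow> (AE \<omega> in S2. ul \<mu> \<omega> = 0) \<longleftrightarrow> \<mu> = \<mu>0"
    and "1 + \<alpha>0 * pv_integral (bracket ul) \<mu>0 = 0"
    and "has_strong_derivative ul u' \<mu>0"
    \<comment> \<open>the zero of \<open>G1\<close> near \<open>(\<alpha>0, \<mu>0)\<close>\<close>
    and "open J" and "is_interval J" and "J \<subseteq> {0<..}" and "\<alpha>0 \<in> J"
    and "\<exists>lam'. continuous_on J lam' \<and> (\<forall>\<alpha>\<in>J. (lam has_real_derivative lam' \<alpha>) (at \<alpha>))"
    and "\<And>\<alpha>. \<alpha> \<in> J \<Longrightarrow> lam \<alpha> > 0"
    and "lam \<alpha>0 = \<mu>0"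
    and "\<And>\<alpha>. \<alpha> \<in> J \<Longrightarrow> G1 ul \<alpha> (lam \<alpha>) = 0"
    \<comment> \<open>the scattering matrix; the formula fixes its version at every energy\<close>
    and "\<And>\<alpha>. \<alpha> > 0 \<Longrightarrow> \<alpha> \<noteq> \<alpha>0 \<Longrightarrow> scattering_matrix u \<alpha> (S \<alpha>)"
    and "\<And>\<alpha> \<mu> v. \<alpha> > 0 \<Longrightarrow> \<alpha> \<noteq> \<alpha>0 \<Longrightarrow> \<mu> > 0 \<Longrightarrow> l2 S2 v \<Longrightarrow>
           AE \<omega> in S2. remainder (S \<alpha> \<mu>) v \<omega> =
             - (2 * complex_of_real pi * \<i> * complex_of_real \<alpha> / G ul \<alpha> \<mu>) *
               l2_inner S2 v (ul \<mu>) * ul \<mu> \<omega>"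
    and "\<And>\<alpha> \<mu>. \<alpha> > 0 \<Longrightarrow> \<alpha> \<noteq> \<alpha>0 \<Longrightarrow> \<mu> > 0 \<Longrightarrow>
           integral_kernel S2 (remainder (S \<alpha> \<mu>)) (K \<alpha> \<mu>)"
    and "orthonormal_basis S2 e"
  shows
    "((\<lambda>\<alpha>. total_cross_section e (S \<alpha> (lam_h ul u' \<mu>0 lam h \<alpha>)) (lam_h ul u' \<mu>0 lam h \<alpha>))
        \<longlongrightarrow> 4 * pi / \<mu>0 * (1 / (h\<^sup>2 + 1))) (at \<alpha>0)
     \<and>
     (l2_norm S2 u' \<noteq> 0 \<longrightarrow>
       (\<exists>\<alpha>k :: nat \<Rightarrow> real.
         (\<forall>k. \<alpha>k k \<in> J \<and> \<alpha>k k \<noteq> \<alpha>0 \<and> lam_h ul u' \<mu>0 lam h (\<alpha>k k) > 0) \<and>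
         \<alpha>k \<longlonglongrightarrow> \<alpha>0 \<and>
         (AE (\<omega>0, \<omega>) in S2 \<Otimes>\<^sub>M S2.
           (\<lambda>k. scattering_amplitude (K (\<alpha>k k) (lam_h ul u' \<mu>0 lam h (\<alpha>k k)))
                  (lam_h ul u' \<mu>0 lam h (\<alpha>k k)) \<omega>0 \<omega>)
           \<longlonglongrightarrow>
           - (4 * complex_of_real pi / complex_of_real (sqrt \<mu>0)) *
             (u' \<omega> * cnj (u' \<omega>0) / complex_of_real ((l2_norm S2 u')\<^sup>2)) *
             (1 / (complex_of_real h + \<i>)))))"
proof (intro conjI impI)
  note \<alpha>0 = assms(1) and \<mu>0 = assms(2) and rapid = assms(5) and zero = assms(7)
    and deriv_u = assms(9) and J = assms(10,12,13)
  define \<Lambda> where "\<Lambda> = lam_h ul u' \<mu>0 lam h"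
  define T where "T \<alpha> = complex_of_real (\<alpha> * (l2_norm S2 (ul (\<Lambda> \<alpha>)))\<^sup>2) / G ul \<alpha> (\<Lambda> \<alpha>)" for \<alpha>
  have cont: "isCont lam \<alpha>0"
    using assms(13,14) DERIV_isCont by blast
  note limits = resonance_limit[OF \<alpha>0 \<mu>0 rapid zero assms(8) J cont assms(15,16,17),
      where h = h and u' = u', folded \<Lambda>_def, folded T_def]
  have \<Lambda>_pos: "\<forall>\<^sub>F \<alpha> in at \<alpha>0. \<Lambda> \<alpha> > 0"
    using order_tendstoD(1)[OF limits(1) \<mu>0] .
  have in_J: "\<forall>\<^sub>F \<alpha> in at \<alpha>0. \<alpha> \<in> J \<and> \<alpha> \<noteq> \<alpha>0"
    using J by (auto simp: eventually_at_topological)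
  have l2_ul: "l2 S2 (ul \<mu>)" if "\<mu> > 0" for \<mu>
    using rapid that by (simp add: smooth_rapid_def)
  have rank_one: "AE \<omega> in S2. remainder (S \<alpha> \<mu>) v \<omega> =
      - (2 * complex_of_real pi * \<i> * complex_of_real \<alpha> / G ul \<alpha> \<mu>) * l2_inner S2 v (ul \<mu>) * ul \<mu> \<omega>"
    if "\<alpha> \<in> J" "\<alpha> \<noteq> \<alpha>0" "\<mu> > 0" "l2 S2 v" for \<alpha> \<mu> v
    using that J by (intro assms(19)) auto
  \<comment> \<open>The Hilbert-Schmidt norm is \<open>2 * pi * cmod (T \<alpha>)\<close>; its
    square times pi / energy gives the constant 4 pi^3.\<close>
  have cross_section: "total_cross_section e (S \<alpha> (\<Lambda> \<alpha>)) (\<Lambda> \<alpha>) = 4 * pi ^ 3 / \<Lambda> \<alpha> * (cmod (T \<alpha>))\<^sup>2"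
    if "\<alpha> \<in> J" "\<alpha> \<noteq> \<alpha>0" "\<Lambda> \<alpha> > 0" for \<alpha>
  proof -
    have "\<alpha> > 0" using that J by auto
    have meas: "remainder (S \<alpha> (\<Lambda> \<alpha>)) v \<in> borel_measurable S2" if v: "l2 S2 v" for v
    proof -
      have "l2 S2 (S \<alpha> (\<Lambda> \<alpha>) v)"
        using assms(18)[OF \<open>\<alpha> > 0\<close> \<open>\<alpha> \<noteq> \<alpha>0\<close>] \<open>\<Lambda> \<alpha> > 0\<close> v
        by (auto simp: scattering_matrix_def l2_operator_def)
      from l2_diff[OF this v] show ?thesis
        unfolding remainder_def[abs_def] by (rule l2_measurable)
    qed
    have "hs_norm S2 e (remainder (S \<alpha> (\<Lambda> \<alpha>)))
        = cmod (- (2 * complex_of_real pi * \<i> * complex_of_real \<alpha> / G ul \<alpha> (\<Lambda> \<alpha>))) * (l2_norm S2 (ul (\<Lambda> \<alpha>)))\<^sup>2"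
      using that by (intro hs_norm_rank_one assms(21) l2_ul meas rank_one)
    also have "\<dots> = 2 * pi * cmod (T \<alpha>)"
      using \<open>\<alpha> > 0\<close> by (simp add: T_def norm_divide norm_mult norm_power l2_norm_nonneg)
    finally show ?thesis
      by (simp add: total_cross_section_def power_mult_distrib power2_eq_square power3_eq_cube)
  qed
  have "((\<lambda>\<alpha>. 4 * pi ^ 3 / \<Lambda> \<alpha> * (cmod (T \<alpha>))\<^sup>2) \<longlongrightarrow>
      4 * pi ^ 3 / \<mu>0 * (cmod (1 / (complex_of_real pi * (complex_of_real h + \<i>))))\<^sup>2) (at \<alpha>0)"
    using \<mu>0 by (intro tendsto_intros limits) auto
  moreover have "4 * pi ^ 3 / \<mu>0 * (cmod (1 / (complex_of_real pi * (complex_of_real h + \<i>))))\<^sup>2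
      = 4 * pi / \<mu>0 * (1 / (h\<^sup>2 + 1))"
  proof -
    have "(cmod (complex_of_real h + \<i>))\<^sup>2 = h\<^sup>2 + 1"
      by (simp add: cmod_power2)
    then show ?thesis
      by (simp add: norm_divide norm_mult power_divide power_mult_distrib power2_eq_square power3_eq_cube)
  qed
  moreover have "\<forall>\<^sub>F \<alpha> in at \<alpha>0. 4 * pi ^ 3 / \<Lambda> \<alpha> * (cmod (T \<alpha>))\<^sup>2
      = total_cross_section e (S \<alpha> (\<Lambda> \<alpha>)) (\<Lambda> \<alpha>)"
    using in_J \<Lambda>_pos by eventually_elim (simp add: cross_section)
  ultimately show "((\<lambda>\<alpha>. total_cross_section e (S \<alpha> (lam_h ul u' \<mu>0 lam h \<alpha>)) (lam_h ul u' \<mu>0 lam h \<alpha>))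
      \<longlongrightarrow> 4 * pi / \<mu>0 * (1 / (h\<^sup>2 + 1))) (at \<alpha>0)"
    unfolding \<Lambda>_def[symmetric] using Lim_transform_eventually by fastforce

  \<comment> \<open>The limiting kernel is divided by the squared norm of \<open>u'\<close>, which
    must be nonzero for the quotients to converge.\<close>
  assume u'_nz: "l2_norm S2 u' \<noteq> 0"
  interpret finite_measure S2 by (rule finite_measure_S2)
  have sf: "sigma_finite_measure S2" by (rule sigma_finite_measure_axioms)
  obtain X where X: "\<And>n. (X n \<in> J \<and> X n \<noteq> \<alpha>0) \<and> \<Lambda> (X n) > 0 \<and> \<Lambda> (X n) \<noteq> \<mu>0" "X \<longlonglongrightarrow> \<alpha>0"
    using eventually_at_sequence[OF eventually_conj[OF in_J eventually_conj[OF \<Lambda>_pos limits(2)]]]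
    by metis
  have X_at: "filterlim X (at \<alpha>0) sequentially"
    using X by (auto simp: filterlim_at)
  \<comment> \<open>Since \<open>ul \<mu>0\<close> vanishes almost everywhere, this is the
    difference quotient of \<open>ul\<close> at \<open>\<mu>0\<close>, so it tends to
    \<open>u'\<close> in the \<open>L2\<close> norm of the sphere.\<close>
  define U where "U n \<omega> = ul (\<Lambda> (X n)) \<omega> / complex_of_real (\<Lambda> (X n) - \<mu>0)" for n \<omega>
  have l2_U: "l2 S2 (U n)" for n
    unfolding U_def[abs_def] using X by (intro l2_divide l2_ul) auto
  have l2_u': "l2 S2 u'"
    using deriv_u by (simp add: has_strong_derivative_def)
  have "filterlim (\<lambda>n. \<Lambda> (X n) - \<mu>0) (at 0) sequentially"
    using X(1) tendsto_diff[OF filterlim_compose[OF limits(1) X_at] tendsto_const, of \<mu>0]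
    by (auto simp: filterlim_at)
  from filterlim_compose[OF _ this] deriv_u
  have "(\<lambda>n. l2_norm S2 (\<lambda>\<omega>. (ul (\<mu>0 + (\<Lambda> (X n) - \<mu>0)) \<omega> - ul \<mu>0 \<omega>) / complex_of_real (\<Lambda> (X n) - \<mu>0) - u' \<omega>))
      \<longlonglongrightarrow> 0"
    unfolding has_strong_derivative_def by blast
  moreover have "l2_norm S2 (\<lambda>\<omega>. (ul (\<mu>0 + (\<Lambda> (X n) - \<mu>0)) \<omega> - ul \<mu>0 \<omega>) / complex_of_real (\<Lambda> (X n) - \<mu>0) - u' \<omega>)
      = l2_norm S2 (\<lambda>\<omega>. U n \<omega> - u' \<omega>)" for n
  proof (rule l2_norm_cong_AE)
    have "AE \<omega> in S2. ul \<mu>0 \<omega> = 0" using zero \<mu>0 by blast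
    then show "AE \<omega> in S2. (ul (\<mu>0 + (\<Lambda> (X n) - \<mu>0)) \<omega> - ul \<mu>0 \<omega>) / complex_of_real (\<Lambda> (X n) - \<mu>0) - u' \<omega>
        = U n \<omega> - u' \<omega>"
      by eventually_elim (simp add: U_def)
    show "(\<lambda>\<omega>. (ul (\<mu>0 + (\<Lambda> (X n) - \<mu>0)) \<omega> - ul \<mu>0 \<omega>) / complex_of_real (\<Lambda> (X n) - \<mu>0) - u' \<omega>)
        \<in> borel_measurable S2"
      using X(1)[of n] \<mu>0 by (intro l2_measurable l2_diff l2_divide l2_ul l2_u') auto
    show "(\<lambda>\<omega>. U n \<omega> - u' \<omega>) \<in> borel_measurable S2"
      by (intro l2_measurable l2_diff l2_U l2_u')
  qed
  ultimately have U_lim: "(\<lambda>n. l2_norm S2 (\<lambda>\<omega>. U n \<omega> - u' \<omega>)) \<longlonglongrightarrow> 0"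
    by simp
  obtain s :: "nat \<Rightarrow> nat" where s: "strict_mono s" "AE \<omega> in S2. (\<lambda>n. U (s n) \<omega>) \<longlonglongrightarrow> u' \<omega>"
    by (rule l2_limit_AE_subseq[OF l2_U l2_u' U_lim])
  have U_norm: "(\<lambda>n. complex_of_real ((l2_norm S2 (U (s n)))\<^sup>2)) \<longlonglongrightarrow> complex_of_real ((l2_norm S2 u')\<^sup>2)"
    unfolding l2_inner_self[symmetric]
    using LIMSEQ_subseq_LIMSEQ[OF U_lim s(1)]
    by (intro l2_inner_tendsto always_eventually allI l2_U l2_u') (simp_all add: o_def)
  define Y where "Y n = X (s n)" for n
  have Y: "Y n \<in> J" "Y n \<noteq> \<alpha>0" "\<Lambda> (Y n) > 0" "\<Lambda> (Y n) \<noteq> \<mu>0" for n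
    using X(1) by (auto simp: Y_def)
  have Y_lim: "Y \<longlonglongrightarrow> \<alpha>0"
    using LIMSEQ_subseq_LIMSEQ[OF X(2) s(1)] by (simp add: Y_def[abs_def] o_def)
  then have Y_at: "filterlim Y (at \<alpha>0) sequentially"
    using Y by (auto simp: filterlim_at)
  let ?c = "\<lambda>n. - (2 * complex_of_real pi * \<i> * complex_of_real (Y n) / G ul (Y n) (\<Lambda> (Y n)))"
  let ?amp = "\<lambda>n. scattering_amplitude (K (Y n) (\<Lambda> (Y n))) (\<Lambda> (Y n))"
  \<comment> \<open>A kernel is determined only up to a null set, which depends on \<open>n\<close>;
    countably many of them are merged at the end.\<close>
  have kernel: "AE (\<omega>0, \<omega>) in S2 \<Otimes>\<^sub>M S2.
      K (Y n) (\<Lambda> (Y n)) \<omega> \<omega>0 = ?c n * (ul (\<Lambda> (Y n)) \<omega> * cnj (ul (\<Lambda> (Y n)) \<omega>0))" for n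
  proof (rule AE_pair_measure_swap[OF sf integral_kernel_unique[OF finite_measure_S2]])
    show "integral_kernel S2 (remainder (S (Y n) (\<Lambda> (Y n)))) (K (Y n) (\<Lambda> (Y n)))"
      using Y[of n] J by (intro assms(20)) auto
    show "integral_kernel S2 (remainder (S (Y n) (\<Lambda> (Y n))))
        (\<lambda>\<omega> \<omega>0. ?c n * (ul (\<Lambda> (Y n)) \<omega> * cnj (ul (\<Lambda> (Y n)) \<omega>0)))"
      using Y[of n] by (intro integral_kernel_rank_one sf l2_ul rank_one)
  qed
  \<comment> \<open>Replacing \<open>ul\<close> by \<open>U\<close> multiplies both the kernel and
    the squared norm by \<open>t\<^sup>2\<close>, as \<open>t\<close> is real, so the normalized
    kernel is unchanged. The prefactors combine to -4 pi^2 because (-2 pi i)^2 = -4 pi^2.\<close>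
  have amp: "?amp n \<omega>0 \<omega> = - 4 * (complex_of_real pi)\<^sup>2 / complex_of_real (sqrt (\<Lambda> (Y n))) * T (Y n)
      * (U (s n) \<omega> * cnj (U (s n) \<omega>0) / complex_of_real ((l2_norm S2 (U (s n)))\<^sup>2))"
    if "K (Y n) (\<Lambda> (Y n)) \<omega> \<omega>0 = ?c n * (ul (\<Lambda> (Y n)) \<omega> * cnj (ul (\<Lambda> (Y n)) \<omega>0))" for n \<omega>0 \<omega>
  proof -
    define t where "t = \<Lambda> (Y n) - \<mu>0"
    have t: "t \<noteq> 0" using Y by (simp add: t_def)
    have ul_U: "ul (\<Lambda> (Y n)) = (\<lambda>\<omega>. complex_of_real t * U (s n) \<omega>)"
      using t by (simp add: U_def t_def Y_def del: of_real_diff)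
    have "l2_norm S2 (ul (\<Lambda> (Y n))) \<noteq> 0"
      using l2_norm_eq_0_iff[OF l2_ul[OF Y(3)]] zero[OF Y(3)] Y(4) by simp
    then have "l2_norm S2 (U (s n)) \<noteq> 0"
      by (auto simp: ul_U l2_norm_cmult)
    moreover have "(l2_norm S2 (ul (\<Lambda> (Y n))))\<^sup>2 = t\<^sup>2 * (l2_norm S2 (U (s n)))\<^sup>2"
      by (simp add: ul_U l2_norm_cmult power_mult_distrib)
    ultimately show ?thesis
      using t unfolding scattering_amplitude_def that T_def unfolding ul_U
      by (simp add: field_simps power2_eq_square)
  qed
  have pt_lim: "(\<lambda>n. - 4 * (complex_of_real pi)\<^sup>2 / complex_of_real (sqrt (\<Lambda> (Y n))) * T (Y n)
      * (U (s n) \<omega> * cnj (U (s n) \<omega>0) / complex_of_real ((l2_norm S2 (U (s n)))\<^sup>2)))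
      \<longlonglongrightarrow> - 4 * (complex_of_real pi)\<^sup>2 / complex_of_real (sqrt \<mu>0)
        * (1 / (complex_of_real pi * (complex_of_real h + \<i>)))
        * (u' \<omega> * cnj (u' \<omega>0) / complex_of_real ((l2_norm S2 u')\<^sup>2))"
    if "(\<lambda>n. U (s n) \<omega>) \<longlonglongrightarrow> u' \<omega>" "(\<lambda>n. U (s n) \<omega>0) \<longlonglongrightarrow> u' \<omega>0" for \<omega>0 \<omega>
    using \<mu>0 u'_nz
    by (intro tendsto_mult tendsto_divide tendsto_const tendsto_of_real tendsto_real_sqrt tendsto_cnj
        that U_norm filterlim_compose[OF limits(1) Y_at] filterlim_compose[OF limits(3) Y_at]) auto
  have limit_eq: "- 4 * (complex_of_real pi)\<^sup>2 / complex_of_real (sqrt \<mu>0)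
        * (1 / (complex_of_real pi * (complex_of_real h + \<i>))) * w
      = - (4 * complex_of_real pi / complex_of_real (sqrt \<mu>0)) * w * (1 / (complex_of_real h + \<i>))" for w
    by (simp add: power2_eq_square)
  have "AE (\<omega>0, \<omega>) in S2 \<Otimes>\<^sub>M S2. (\<lambda>n. ?amp n \<omega>0 \<omega>)
      \<longlonglongrightarrow> - (4 * complex_of_real pi / complex_of_real (sqrt \<mu>0)) *
             (u' \<omega> * cnj (u' \<omega>0) / complex_of_real ((l2_norm S2 u')\<^sup>2)) *
             (1 / (complex_of_real h + \<i>))"
  proof -
    have "AE z in S2 \<Otimes>\<^sub>M S2. \<forall>n. case z of (\<omega>0, \<omega>) \<Rightarrow>
        K (Y n) (\<Lambda> (Y n)) \<omega> \<omega>0 = ?c n * (ul (\<Lambda> (Y n)) \<omega> * cnj (ul (\<Lambda> (Y n)) \<omega>0))"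
      using kernel by (simp add: AE_all_countable)
    moreover have fst: "AE (\<omega>0, \<omega>) in S2 \<Otimes>\<^sub>M S2. (\<lambda>n. U (s n) \<omega>0) \<longlonglongrightarrow> u' \<omega>0"
      by (rule AE_pair_measure_fst[OF sf s(2)])
    \<comment> \<open>Convergence in the outgoing direction follows from the incoming one by
      exchanging the factors.\<close>
    moreover have "AE (\<omega>0, \<omega>) in S2 \<Otimes>\<^sub>M S2. (\<lambda>n. U (s n) \<omega>) \<longlonglongrightarrow> u' \<omega>"
      by (rule AE_pair_measure_swap[OF sf fst])
    ultimately show ?thesis
    proof eventually_elim
      case (elim z)
      obtain \<omega>0 \<omega> where z: "z = (\<omega>0, \<omega>)" by (cases z)
      have "?amp n \<omega>0 \<omega> = - 4 * (complex_of_real pi)\<^sup>2 / complex_of_real (sqrt (\<Lambda> (Y n))) * T (Y n)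
          * (U (s n) \<omega> * cnj (U (s n) \<omega>0) / complex_of_real ((l2_norm S2 (U (s n)))\<^sup>2))" for n
        using elim(1) by (intro amp) (simp only: z prod.case)
      moreover have "(\<lambda>n. U (s n) \<omega>) \<longlonglongrightarrow> u' \<omega>" "(\<lambda>n. U (s n) \<omega>0) \<longlonglongrightarrow> u' \<omega>0"
        using elim(2,3) by (simp_all add: z)
      note pt_lim[OF this]
      ultimately show ?case
        by (simp only: z prod.case limit_eq)
    qed
  qed
  then show "\<exists>\<alpha>k :: nat \<Rightarrow> real.
         (\<forall>k. \<alpha>k k \<in> J \<and> \<alpha>k k \<noteq> \<alpha>0 \<and> lam_h ul u' \<mu>0 lam h (\<alpha>k k) > 0) \<and>
         \<alpha>k \<longlonglongrightarrow> \<alpha>0 \<and>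
         (AE (\<omega>0, \<omega>) in S2 \<Otimes>\<^sub>M S2.
           (\<lambda>k. scattering_amplitude (K (\<alpha>k k) (lam_h ul u' \<mu>0 lam h (\<alpha>k k)))
                  (lam_h ul u' \<mu>0 lam h (\<alpha>k k)) \<omega>0 \<omega>)
           \<longlonglongrightarrow>
           - (4 * complex_of_real pi / complex_of_real (sqrt \<mu>0)) *
             (u' \<omega> * cnj (u' \<omega>0) / complex_of_real ((l2_norm S2 u')\<^sup>2)) *
             (1 / (complex_of_real h + \<i>)))"
    unfolding \<Lambda>_def[symmetric] using Y Y_lim by (intro exI[of _ Y]) auto
qed

end
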